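(* Let $n\geqslant 2$, let $A_0>0$, $R_0>0$, $\delta>0$, let $D\subset\mathbb{R}^n$ be a domain, let $x_0\in\partial D$, $x_0\neq\infty$, let $A\subset D$ be a path connected continuum, and let $Q:D\to[0,\infty]$ be a Lebesgue measurable function (extended by zero outside $D$). Assume that the following conditions hold: 1) there is $r_0'=r_0'(x_0)>0$ such that the set $B(x_0,r)\cap D$ is connected for any $0<r<r_0'$; 2) there is $0<C=C(x_0)<\infty$ such that $$\limsup_{\varepsilon\to 0}\frac{1}{\Omega_n\,\varepsilon^n}\int_{B(x_0,\varepsilon)\cap D}Q(x)\,dm(x)\leqslant C.$$ Then there are $\widetilde{\varepsilon_0}=\widetilde{\varepsilon_0}(x_0)>0$ and a number $\alpha=\alpha(n,\delta,C,R_0,x_0)>0$ such that $$|f(x)-f(y)|\leqslant\alpha\cdot\max\{|x-x_0|^{\beta_n},\,|y-x_0|^{\beta_n}\}$$ holds for any $x,y\in B(x_0,\widetilde{\varepsilon_0})\cap D$ and any $f\in\mathfrak{F}^{A_0,R_0}_{Q,A,\delta}(D,x_0)$, where $$\beta_n=\left(\frac{n\log 2}{A_0\,C\,2^{n+1}}\right)^{\frac{1}{n-1}}.$$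
   Context: Notation: $B(x_0,r)=\{x\in\mathbb{R}^n:|x-x_0|<r\}$, $S(x_0,r)=\{x\in\mathbb{R}^n:|x-x_0|=r\}$, $A(x_0,r_1,r_2)=\{x\in\mathbb{R}^n:r_1<|x-x_0|<r_2\}$; $m$ is Lebesgue measure in $\mathbb{R}^n$ and $\Omega_n=m(B(0,1))$. $\overline{\mathbb{R}^n}=\mathbb{R}^n\cup\{\infty\}$, and boundaries of domains are taken in $\overline{\mathbb{R}^n}$. A continuum is a compact connected set; $\mathrm{diam}$ is the Euclidean diameter. For sets $E,F$ and $G$, $\Gamma(E,F,G)$ is the family of all paths (continuous maps) $\gamma:[a,b]\to G$ with $\gamma(a)\in E$, $\gamma(b)\in F$. For a family $\Gamma$ of paths in the domain of $f$, $f(\Gamma)=\{f\circ\gamma:\gamma\in\Gamma\}$. $M(\Gamma)$ is the conformal modulus of the path family $\Gamma$: the infimum of $\int_{\mathbb{R}^n}\varrho^n\,dm$ over all Borel $\varrho:\mathbb{R}^n\to[0,\infty]$ with $\int_\gamma\varrho\,ds\geqslant1$ for every locally rectifiable $\gamma\in\Gamma$. Ring $Q$-condition at $x_0$: a mapping $f:D\to\overline{\mathbb{R}^n}$ is a ring $Q$-mapping at $x_0\in\overline{D}$, $x_0\neq\infty$, if for some $r_0=r_0(x_0)>0$ the inequality $$M\big(f(\Gamma(S(x_0,r_1),S(x_0,r_2),D))\big)\leqslant\int_{A(x_0,r_1,r_2)}Q(x)\,\eta^n(|x-x_0|)\,dm(x)$$ holds for all $0<r_1<r_2<r_0$ and all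 Lebesgue measurable $\eta:(r_1,r_2)\to[0,\infty]$ with $\int_{r_1}^{r_2}\eta(r)\,dr\geqslant1$. The radius $r_0=r_0(x_0)$ depends only on the point $x_0$; it is the same for all mappings of the family considered. A domain $G\subset\mathbb{R}^n$ satisfies the quasiextremal distance ($QED$) condition with constant $A_0$ if $M(\Gamma(E,F,\mathbb{R}^n))\leqslant A_0\,M(\Gamma(E,F,G))$ for any continua $E,F\subset G$. $\mathfrak{F}^{A_0,R_0}_{Q,A,\delta}(D,x_0)$ is the family of all homeomorphisms $f$ of $D$ onto $f(D)\subset B(0,R_0)$ that satisfy the ring $Q$-condition at $x_0$ and are such that $\mathrm{diam}\,f(A)\geqslant\delta$ and the domain $D_f'=f(D)$ satisfies the $QED$ condition with constant $A_0$. *)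

theory Defs
  imports "HOL-Analysis.Analysis"
begin

section \<open>Line integrals with respect to arc length\<close>

text \<open>Paths are the library's continuous maps on the unit interval; nothing below changes under
  an affine change of the parameter interval.\<close>

text \<open>Supremum of the lengths of the polygons inscribed in the restriction of \<open>\<gamma>\<close> to \<open>{a..b}\<close>; the
  sorted lists are the (not necessarily complete) partitions of \<open>{a..b}\<close>.\<close>

definition path_length_on :: "(real \<Rightarrow> 'a::metric_space) \<Rightarrow> real \<Rightarrow> real \<Rightarrow> ennreal" where
  "path_length_on \<gamma> a b =
     (SUP ts\<in>{ts. sorted ts \<and> set ts \<subseteq> {a..b}}.
        \<Sum>i<length ts - 1. ennreal (dist (\<gamma> (ts ! i)) (\<gamma> (ts ! Suc i))))"

text \<open>The parameter interval is compact, so local rectifiability is rectifiability.\<close>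

definition rectifiable_path :: "(real \<Rightarrow> 'a::metric_space) \<Rightarrow> bool" where
  "rectifiable_path \<gamma> \<longleftrightarrow> path \<gamma> \<and> path_length_on \<gamma> 0 1 < \<infinity>"

text \<open>The normal representation \<open>\<gamma>\<^sup>0\<close>, determined by \<open>\<gamma> = \<gamma>\<^sup>0 \<circ> s\<close> for the length function
  \<open>s t = path_length_on \<gamma> 0 t\<close>. For rectifiable \<open>\<gamma>\<close> and \<open>s\<close> between 0 and the length, a parameter
  \<open>t\<close> exists, and its choice is irrelevant because \<open>\<gamma>\<close> is constant where the length function is.\<close>

definition arclength_param :: "(real \<Rightarrow> 'a::metric_space) \<Rightarrow> real \<Rightarrow> 'a" where
  "arclength_param \<gamma> s = \<gamma> (SOME t. t \<in> {0..1} \<and> path_length_on \<gamma> 0 t = ennreal s)"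

definition line_integral :: "('a::metric_space \<Rightarrow> ennreal) \<Rightarrow> (real \<Rightarrow> 'a) \<Rightarrow> ennreal" where
  "line_integral \<rho> \<gamma> =
     (\<integral>\<^sup>+s\<in>{0..enn2real (path_length_on \<gamma> 0 1)}. \<rho> (arclength_param \<gamma> s) \<partial>lborel)"


section \<open>Modulus of path families\<close>

definition paths_between ::
    "'a::topological_space set \<Rightarrow> 'a set \<Rightarrow> 'a set \<Rightarrow> (real \<Rightarrow> 'a) set" where
  "paths_between E F G =
     {\<gamma>. path \<gamma> \<and> path_image \<gamma> \<subseteq> G \<and> pathstart \<gamma> \<in> E \<and> pathfinish \<gamma> \<in> F}"

definition image_paths :: "('a \<Rightarrow> 'b) \<Rightarrow> (real \<Rightarrow> 'a) set \<Rightarrow> (real \<Rightarrow> 'b) set" where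
  "image_paths f \<Gamma> = (\<lambda>\<gamma>. f \<circ> \<gamma>) ` \<Gamma>"

definition admissible :: "(real \<Rightarrow> real^'n) set \<Rightarrow> (real^'n \<Rightarrow> ennreal) set" where
  "admissible \<Gamma> =
     {\<rho>. \<rho> \<in> borel_measurable borel \<and> (\<forall>\<gamma>\<in>\<Gamma>. rectifiable_path \<gamma> \<longrightarrow> line_integral \<rho> \<gamma> \<ge> 1)}"

definition modulus :: "(real \<Rightarrow> real^'n) set \<Rightarrow> ennreal" where
  "modulus \<Gamma> = (INF \<rho>\<in>admissible \<Gamma>. \<integral>\<^sup>+x. \<rho> x ^ CARD('n) \<partial>lebesgue)"


section \<open>The mapping class\<close>

definition annulus :: "'a::metric_space \<Rightarrow> real \<Rightarrow> real \<Rightarrow> 'a set" where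
  "annulus x0 r1 r2 = {x. r1 < dist x x0 \<and> dist x x0 < r2}"

text \<open>The radius \<open>r0\<close> is a parameter, since it is shared by all mappings of the family.
  \<open>Q\<close> is assumed to be extended by zero outside \<open>D\<close>.\<close>

definition ring_Q_mapping ::
    "real \<Rightarrow> (real^'n) set \<Rightarrow> (real^'n \<Rightarrow> ennreal) \<Rightarrow> real^'n \<Rightarrow> (real^'n \<Rightarrow> real^'n) \<Rightarrow> bool" where
  "ring_Q_mapping r0 D Q x0 f \<longleftrightarrow>
     (\<forall>r1 r2. \<forall>\<eta>::real \<Rightarrow> ennreal.
        0 < r1 \<and> r1 < r2 \<and> r2 < r0 \<and>
        \<eta> \<in> borel_measurable (lebesgue_on {r1<..<r2}) \<and>
        (\<integral>\<^sup>+r\<in>{r1<..<r2}. \<eta> r \<partial>lebesgue) \<ge> 1 \<longrightarrow>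
        modulus (image_paths f (paths_between (sphere x0 r1) (sphere x0 r2) D))
          \<le> (\<integral>\<^sup>+x\<in>annulus x0 r1 r2. Q x * \<eta> (norm (x - x0)) ^ CARD('n) \<partial>lebesgue))"

definition continuum :: "'a::topological_space set \<Rightarrow> bool" where
  "continuum E \<longleftrightarrow> compact E \<and> connected E"

definition QED_domain :: "real \<Rightarrow> (real^'n) set \<Rightarrow> bool" where
  "QED_domain A0 G \<longleftrightarrow> open G \<and> connected G \<and>
     (\<forall>E F. continuum E \<and> continuum F \<and> E \<subseteq> G \<and> F \<subseteq> G \<longrightarrow>
        modulus (paths_between E F UNIV) \<le> ennreal A0 * modulus (paths_between E F G))"

text \<open>The class \<open>\<FF>\<close> with upper indices \<open>A0, R0\<close> and lower indices \<open>Q, A, \<delta>\<close>.\<close>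

definition QED_ring_family ::
    "real \<Rightarrow> real \<Rightarrow> (real^'n \<Rightarrow> ennreal) \<Rightarrow> (real^'n) set \<Rightarrow> real \<Rightarrow> real \<Rightarrow> (real^'n) set \<Rightarrow> real^'n
       \<Rightarrow> (real^'n \<Rightarrow> real^'n) set" where
  "QED_ring_family A0 R0 Q A \<delta> r0 D x0 =
     {f. (\<exists>g. homeomorphism D (f ` D) f g) \<and> f ` D \<subseteq> ball 0 R0 \<and>
         ring_Q_mapping r0 D Q x0 f \<and> diameter (f ` A) \<ge> \<delta> \<and> QED_domain A0 (f ` D)}"

definition Omega :: "'n::finite itself \<Rightarrow> real" where
  "Omega _ = measure lebesgue (ball (0::real^'n) 1)"

definition beta_exp :: "nat \<Rightarrow> real \<Rightarrow> real \<Rightarrow> real" where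
  "beta_exp n A0 C = (real n * ln 2 / (A0 * C * 2 ^ (n + 1))) powr (1 / (real n - 1))"

end

theory Submission
  imports Defs
begin

text \<open>Let \<open>d = |f x - f y|\<close>, let \<open>E\<close> be the image of a path from \<open>x\<close> to \<open>y\<close> in a small ball about
  \<open>x0\<close>, and let \<open>F\<close> be a curve in \<open>f ` A\<close> joining two points at distance at least \<open>\<delta>\<close>. Curves joining
  \<open>E\<close> and \<open>F\<close> inside the image contain images of curves crossing a ring about \<open>x0\<close>, so the ring
  condition with the weight \<open>1 / (r ln (r2 / r1))\<close>, the dyadic bound for \<open>Q\<close> and the QED condition bound
  the modulus of all curves joining \<open>E\<close> and \<open>F\<close> from above by a multiple of \<open>ln (r2 / r1) ^ (1 - n)\<close>.
  From below it is asymptotically \<open>n \<Omega> / ln (1 / d) ^ (n - 1)\<close>: for an admissible density of small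
  energy, average the line integral over the paths \<open>p \<rightarrow> z \<rightarrow> a + T (z - a) \<rightarrow> q\<close> with \<open>p \<in> E\<close>, \<open>q \<in> F\<close>
  and \<open>z\<close> uniform in a ring of radius comparable to \<open>diam E\<close> about a point \<open>a \<in> E\<close>. The radial part
  yields the main term with the sharp constant, by polar coordinates without spheres; the two end
  parts contribute bounded terms, because connectedness lets \<open>p\<close> and \<open>q\<close> be spread out along a
  direction, so that small balls rarely contain them.\<close>

section \<open>Length of paths\<close>

text \<open>The exponent \<open>beta_exp\<close> is prescribed. A multiplicative loss in either
  modulus bound changes it, while an additive error in the lower bound only enlarges \<alpha>. Hence
  the lower bound is derived with the exact leading constant \<open>n * unit_ball_vol n\<close> of a
  spherical ring but with crude end terms. Young's inequality with a free parameter c takes the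
  place of Hoelder's; c is set to the expected density, which is \<kappa> / |w - a| on the radial
  part and a power of the position on the segment on the end parts. A second obstacle is that
  \<alpha> must be fixed before D, Q and the radii are known, whereas the ratio r1 / r2 contains the
  radius r2 below which Q is controlled. The factor 2 in \<open>2 ^ (n + 1)\<close> is the budget
  for this: passing from the limsup to actual radii costs 5 / 4 and rounding the number of dyadic
  shells costs 6 / 5, together 3 / 2 < 2. What remains gives a decay exponent strictly above
  \<open>beta_exp\<close>, and the surplus swallows r2 once the points are close enough to
  x0.\<close>

fun polygon_length :: "(real \<Rightarrow> 'a::metric_space) \<Rightarrow> real list \<Rightarrow> real" where
  "polygon_length \<gamma> [] = 0"
| "polygon_length \<gamma> [t] = 0"
| "polygon_length \<gamma> (t # u # ts) = dist (\<gamma> t) (\<gamma> u) + polygon_length \<gamma> (u # ts)"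

lemma polygon_length_nonneg [simp]: "polygon_length \<gamma> ts \<ge> 0"
  by (induction \<gamma> ts rule: polygon_length.induct) auto

text \<open>The indexed sum is traded for a recursion on lists, because cutting, refining and
  concatenating partitions are then list inductions.\<close>

lemma polygon_length_eq_sum:
  "(\<Sum>i<length ts - 1. ennreal (dist (\<gamma> (ts ! i)) (\<gamma> (ts ! Suc i)))) = ennreal (polygon_length \<gamma> ts)"
proof (induction \<gamma> ts rule: polygon_length.induct)
  case (3 \<gamma> t u ts)
  have "(\<Sum>i<length (t # u # ts) - 1. ennreal (dist (\<gamma> ((t # u # ts) ! i)) (\<gamma> ((t # u # ts) ! Suc i))))
      = ennreal (dist (\<gamma> t) (\<gamma> u)) + (\<Sum>i<length (u # ts) - 1. ennreal (dist (\<gamma> ((u # ts) ! i)) (\<gamma> ((u # ts) ! Suc i))))"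
    by (simp add: sum.lessThan_Suc_shift del: sum.lessThan_Suc)
  then show ?case
    using 3 by (simp del: length_Cons)
qed auto

lemma path_length_on_eq:
  "path_length_on \<gamma> a b = (SUP ts\<in>{ts. sorted ts \<and> set ts \<subseteq> {a..b}}. ennreal (polygon_length \<gamma> ts))"
  unfolding path_length_on_def polygon_length_eq_sum ..

lemma polygon_length_le_path_length_on:
  "sorted ts \<Longrightarrow> set ts \<subseteq> {a..b} \<Longrightarrow> ennreal (polygon_length \<gamma> ts) \<le> path_length_on \<gamma> a b"
  unfolding path_length_on_eq by (intro SUP_upper) auto

lemma polygon_length_append_Cons:
  "polygon_length \<gamma> (xs @ t # ys) = polygon_length \<gamma> (xs @ [t]) + polygon_length \<gamma> (t # ys)"
proof (induction xs)
  case (Cons x xs)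
  then show ?case by (cases xs) auto
qed simp

lemma polygon_length_append_le_insert: "polygon_length \<gamma> (xs @ ys) \<le> polygon_length \<gamma> (xs @ t # ys)"
proof (induction xs)
  case Nil
  show ?case by (cases ys) auto
next
  case (Cons x xs)
  show ?case
  proof (cases xs)
    case Nil
    then show ?thesis
      by (cases ys) (auto simp: add.assoc[symmetric] intro: dist_triangle)
  qed (use Cons in auto)
qed

lemma polygon_length_append_ge: "polygon_length \<gamma> xs + polygon_length \<gamma> ys \<le> polygon_length \<gamma> (xs @ ys)"
proof (induction xs)
  case (Cons x xs)
  show ?case
  proof (cases xs)
    case Nil
    then show ?thesis by (cases ys) auto
  qed (use Cons in auto)
qed simp

lemma polygon_length_cong:
  "(\<And>t. t \<in> set ts \<Longrightarrow> \<gamma> t = \<gamma>' t) \<Longrightarrow> polygon_length \<gamma> ts = polygon_length \<gamma>' ts"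
  by (induction \<gamma> ts rule: polygon_length.induct) auto

lemma polygon_length_map: "polygon_length \<gamma> (map \<phi> ts) = polygon_length (\<gamma> \<circ> \<phi>) ts"
  by (induction ts rule: induct_list012) auto

lemma sorted_filter_le_append:
  "sorted (ts::'b::linorder list) \<Longrightarrow> ts = filter (\<lambda>t. t \<le> b) ts @ filter (\<lambda>t. b < t) ts"
proof (induction ts)
  case (Cons x ts)
  show ?case
  proof (cases "x \<le> b")
    case False
    then have "filter (\<lambda>t. t \<le> b) ts = []" "filter (\<lambda>t. b < t) ts = ts"
      using Cons.prems by (auto simp: filter_empty_conv intro!: filter_True)
    then show ?thesis using False by simp
  qed (use Cons in auto)
qed simp

lemma polygon_length_split:
  assumes "sorted ts"
  shows "polygon_length \<gamma> ts \<le> polygon_length \<gamma> (filter (\<lambda>t. t \<le> b) ts @ [b])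
                           + polygon_length \<gamma> (b # filter (\<lambda>t. b < t) ts)"
  using polygon_length_append_le_insert[of \<gamma> "filter (\<lambda>t. t \<le> b) ts" "filter (\<lambda>t. b < t) ts" b]
    sorted_filter_le_append[OF assms, of b] polygon_length_append_Cons by metis

text \<open>Inserting b into a partition of \<open>{a..c}\<close> gives one inequality,
  concatenating partitions the other. Since partitions need not contain the end points, the
  concatenation needs no care at b.\<close>

lemma path_length_on_add:
  assumes "a \<le> b" "b \<le> c"
  shows "path_length_on \<gamma> a c = path_length_on \<gamma> a b + path_length_on \<gamma> b c"
proof (rule antisym)
  show "path_length_on \<gamma> a c \<le> path_length_on \<gamma> a b + path_length_on \<gamma> b c"
    unfolding path_length_on_eq[of \<gamma> a c]
  proof (rule SUP_least, clarify)
    fix ts assume ts: "sorted ts" "set ts \<subseteq> {a..c}"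
    have "ennreal (polygon_length \<gamma> ts) \<le> ennreal (polygon_length \<gamma> (filter (\<lambda>t. t \<le> b) ts @ [b]))
        + ennreal (polygon_length \<gamma> (b # filter (\<lambda>t. b < t) ts))"
      using polygon_length_split[OF ts(1), of \<gamma> b] by (simp flip: ennreal_plus)
    also have "\<dots> \<le> path_length_on \<gamma> a b + path_length_on \<gamma> b c"
      using ts assms
      by (intro add_mono polygon_length_le_path_length_on)
         (auto simp: sorted_append intro: sorted_wrt_filter)
    finally show "ennreal (polygon_length \<gamma> ts) \<le> path_length_on \<gamma> a b + path_length_on \<gamma> b c" .
  qed
next
  have ne: "{ts::real list. sorted ts \<and> set ts \<subseteq> {u..v}} \<noteq> {}" for u v
    by (rule ex_in_conv[THEN iffD1], rule exI[of _ "[]"]) simp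
  have *: "ennreal (polygon_length \<gamma> xs) + ennreal (polygon_length \<gamma> ys) \<le> path_length_on \<gamma> a c"
    if "sorted xs" "set xs \<subseteq> {a..b}" "sorted ys" "set ys \<subseteq> {b..c}" for xs ys
  proof -
    have "ennreal (polygon_length \<gamma> xs) + ennreal (polygon_length \<gamma> ys) \<le> ennreal (polygon_length \<gamma> (xs @ ys))"
      using polygon_length_append_ge[of \<gamma> xs ys] by (simp flip: ennreal_plus)
    also have "\<dots> \<le> path_length_on \<gamma> a c"
      using that assms
      by (intro polygon_length_le_path_length_on) (force simp: sorted_append subset_eq)+
    finally show ?thesis .
  qed
  show "path_length_on \<gamma> a b + path_length_on \<gamma> b c \<le> path_length_on \<gamma> a c"
    unfolding path_length_on_eq[of \<gamma> a b] path_length_on_eq[of \<gamma> b c]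
    unfolding ennreal_SUP_add_left[OF ne, symmetric]
  proof (rule SUP_least)
    fix xs :: "real list" assume xs: "xs \<in> {ts. sorted ts \<and> set ts \<subseteq> {a..b}}"
    have "ennreal (polygon_length \<gamma> xs) + (SUP ys\<in>{ts. sorted ts \<and> set ts \<subseteq> {b..c}}. ennreal (polygon_length \<gamma> ys))
        = (SUP ys\<in>{ts. sorted ts \<and> set ts \<subseteq> {b..c}}. ennreal (polygon_length \<gamma> xs) + ennreal (polygon_length \<gamma> ys))"
      by (rule ennreal_SUP_add_right[OF ne])
    also have "\<dots> \<le> path_length_on \<gamma> a c"
      using * xs by (intro SUP_least) auto
    finally show "ennreal (polygon_length \<gamma> xs) + (SUP ys\<in>{ts. sorted ts \<and> set ts \<subseteq> {b..c}}. ennreal (polygon_length \<gamma> ys))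
        \<le> path_length_on \<gamma> a c" .
  qed
qed

lemma path_length_on_mono:
  assumes "a \<le> a'" "b' \<le> b"
  shows "path_length_on \<gamma> a' b' \<le> path_length_on \<gamma> a b"
  unfolding path_length_on_eq using assms by (intro SUP_subset_mono) auto

lemma path_length_on_refl [simp]: "path_length_on \<gamma> a a = 0"
proof -
  have "polygon_length \<gamma> ts = 0" if "set ts \<subseteq> {a}" for ts
    using that by (induction ts rule: induct_list012) auto
  then show ?thesis
    unfolding path_length_on_eq by (intro antisym SUP_least) auto
qed

lemma dist_le_path_length_on:
  "a \<le> b \<Longrightarrow> ennreal (dist (\<gamma> a) (\<gamma> b)) \<le> path_length_on \<gamma> a b"
  using polygon_length_le_path_length_on[of "[a, b]" a b \<gamma>] by simp

lemma path_length_on_cong: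
  assumes "\<And>t. t \<in> {a..b} \<Longrightarrow> \<gamma> t = \<gamma>' t"
  shows "path_length_on \<gamma> a b = path_length_on \<gamma>' a b"
  unfolding path_length_on_eq
  by (intro SUP_cong) (use assms in \<open>auto intro!: arg_cong[where f = ennreal] polygon_length_cong\<close>)

lemma path_length_on_affine:
  assumes "0 < c"
  shows "path_length_on (\<lambda>t. \<gamma> (u + c * t)) a b = path_length_on \<gamma> (u + c * a) (u + c * b)"
proof (rule antisym)
  show "path_length_on (\<lambda>t. \<gamma> (u + c * t)) a b \<le> path_length_on \<gamma> (u + c * a) (u + c * b)"
    unfolding path_length_on_eq[of "\<lambda>t. \<gamma> (u + c * t)"]
  proof (rule SUP_least, clarify)
    fix ts assume ts: "sorted ts" "set ts \<subseteq> {a..b}"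
    have "polygon_length (\<lambda>t. \<gamma> (u + c * t)) ts = polygon_length \<gamma> (map (\<lambda>t. u + c * t) ts)"
      by (simp add: polygon_length_map o_def)
    also have "ennreal \<dots> \<le> path_length_on \<gamma> (u + c * a) (u + c * b)"
      using ts assms
      by (intro polygon_length_le_path_length_on) (auto simp: sorted_map intro: sorted_wrt_mono_rel)
    finally show "ennreal (polygon_length (\<lambda>t. \<gamma> (u + c * t)) ts) \<le> path_length_on \<gamma> (u + c * a) (u + c * b)" .
  qed
  show "path_length_on \<gamma> (u + c * a) (u + c * b) \<le> path_length_on (\<lambda>t. \<gamma> (u + c * t)) a b"
    unfolding path_length_on_eq[of \<gamma>]
  proof (rule SUP_least, clarify)
    fix ts assume ts: "sorted ts" "set ts \<subseteq> {u + c * a..u + c * b}"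
    have "polygon_length \<gamma> ts = polygon_length (\<lambda>t. \<gamma> (u + c * t)) (map (\<lambda>t. (t - u) / c) ts)"
      using assms by (simp add: polygon_length_map o_def)
    also have "ennreal \<dots> \<le> path_length_on (\<lambda>t. \<gamma> (u + c * t)) a b"
      using ts assms
      by (intro polygon_length_le_path_length_on)
         (force simp: sorted_map divide_right_mono field_simps intro: sorted_wrt_mono_rel)+
    finally show "ennreal (polygon_length \<gamma> ts) \<le> path_length_on (\<lambda>t. \<gamma> (u + c * t)) a b" .
  qed
qed

lemma polygon_length_le_card:
  assumes "\<And>s t. s \<in> set ts \<Longrightarrow> t \<in> set ts \<Longrightarrow> dist (\<gamma> s) (\<gamma> t) \<le> e" "0 \<le> e"
  shows "polygon_length \<gamma> ts \<le> real (length ts) * e"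
  using assms
proof (induction ts rule: induct_list012)
  case (3 x y zs)
  have "polygon_length \<gamma> (y # zs) \<le> real (length (y # zs)) * e"
    using 3 by auto
  moreover have "dist (\<gamma> x) (\<gamma> y) \<le> e"
    using 3 by auto
  ultimately show ?case
    by (simp add: algebra_simps)
qed auto

text \<open>A nearly optimal partition with k points meets a short interval in at most k points, which
  together with the end points contribute little; hence the length of a short interval is small.\<close>

lemma path_length_on_small:
  assumes cont: "continuous_on {a..b} \<gamma>" and fin: "path_length_on \<gamma> a b < \<infinity>" and "0 < e"
  obtains d where "d > 0"
    and "\<And>u v. a \<le> u \<Longrightarrow> u \<le> v \<Longrightarrow> v \<le> b \<Longrightarrow> v - u < d \<Longrightarrow> path_length_on \<gamma> u v \<le> ennreal e"
proof -
  obtain L where L: "path_length_on \<gamma> a b = ennreal L" "L \<ge> 0"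
    using fin by (cases "path_length_on \<gamma> a b") auto
  \<comment> \<open>For \<open>L = 0\<close> the truncated value \<open>ennreal (L - e / 2)\<close>
    equals the length itself, so no partition exceeds it strictly; the empty list serves
    instead.\<close>
  have "ennreal (L - e / 2) < path_length_on \<gamma> a b \<or> L = 0"
    unfolding L using L \<open>0 < e\<close>
    by (cases "0 \<le> L - e / 2") (auto simp: ennreal_less_iff ennreal_neg)
  then obtain ts where ts: "sorted ts" "set ts \<subseteq> {a..b}" "L - e / 2 \<le> polygon_length \<gamma> ts"
  proof
    assume "ennreal (L - e / 2) < path_length_on \<gamma> a b"
    then obtain ts where "sorted ts" "set ts \<subseteq> {a..b}" "ennreal (L - e / 2) < ennreal (polygon_length \<gamma> ts)"
      unfolding path_length_on_eq by (auto simp: less_SUP_iff)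
    then show ?thesis using that[of ts]
      by (meson ennreal_leI leI less_imp_le not_le)
  next
    assume "L = 0"
    then show ?thesis using that[of "[]"] \<open>0 < e\<close> by simp
  qed
  \<comment> \<open>The 2 accounts for u and v, which join the at most \<open>length ts\<close>
    points of ts between them; edges of length at most e / (2 * k) then add up to at most e /
    2.\<close>
  define k where "k = length ts + 2"
  have "uniformly_continuous_on {a..b} \<gamma>"
    using cont by (simp add: compact_uniformly_continuous)
  moreover have "e / (2 * k) > 0"
    using \<open>0 < e\<close> by (simp add: k_def)
  ultimately obtain d where "d > 0"
    and d: "\<And>s t. s \<in> {a..b} \<Longrightarrow> t \<in> {a..b} \<Longrightarrow> dist s t < d \<Longrightarrow> dist (\<gamma> s) (\<gamma> t) < e / (2 * k)"
    unfolding uniformly_continuous_on_def by metis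
  show ?thesis
  proof (rule that[OF \<open>d > 0\<close>])
    fix u v assume uv: "a \<le> u" "u \<le> v" "v \<le> b" "v - u < d"
    define ys where "ys = filter (\<lambda>t. t \<le> v) (filter (\<lambda>t. u < t) ts)"
    define zs where "zs = filter (\<lambda>t. v < t) (filter (\<lambda>t. u < t) ts)"
    have ys: "set (u # ys @ [v]) \<subseteq> {u..v}" "length (u # ys @ [v]) \<le> k"
      using uv le_trans[OF length_filter_le length_filter_le, of "\<lambda>t. t \<le> v" "\<lambda>t. u < t" ts]
      unfolding ys_def k_def by auto
    have *: "polygon_length \<gamma> (u # ys @ [v]) \<le> e / 2"
    proof -
      have "polygon_length \<gamma> (u # ys @ [v]) \<le> length (u # ys @ [v]) * (e / (2 * k))"
      proof (rule polygon_length_le_card)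
        fix s t assume "s \<in> set (u # ys @ [v])" "t \<in> set (u # ys @ [v])"
        then have "s \<in> {u..v}" "t \<in> {u..v}" using ys(1) by blast+
        then show "dist (\<gamma> s) (\<gamma> t) \<le> e / (2 * k)"
          using uv by (intro less_imp_le d) (auto simp: dist_real_def)
      qed (use \<open>0 < e\<close> in simp)
      also have "\<dots> \<le> k * (e / (2 * k))"
        using ys(2) \<open>0 < e\<close> by (intro mult_right_mono) auto
      also have "\<dots> = e / 2" by (simp add: k_def field_simps)
      finally show ?thesis .
    qed
    have s1: "sorted (filter (\<lambda>t. u < t) ts)"
      using ts(1) by (simp add: sorted_wrt_filter)
    have "polygon_length \<gamma> (u # filter (\<lambda>t. u < t) ts) \<le> polygon_length \<gamma> (u # ys @ v # zs)"
      using polygon_length_append_le_insert[of \<gamma> "u # ys" zs v] sorted_filter_le_append[OF s1, of v]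
      unfolding ys_def zs_def by simp
    also have "\<dots> = polygon_length \<gamma> (u # ys @ [v]) + polygon_length \<gamma> (v # zs)"
      using polygon_length_append_Cons[of \<gamma> "u # ys" v zs] by simp
    finally have "L - e / 2 \<le> polygon_length \<gamma> (filter (\<lambda>t. t \<le> u) ts @ [u]) + e / 2 + polygon_length \<gamma> (v # zs)"
      using polygon_length_split[OF ts(1), of \<gamma> u] ts(3) * by linarith
    then have "ennreal L \<le> ennreal (polygon_length \<gamma> (filter (\<lambda>t. t \<le> u) ts @ [u]) + polygon_length \<gamma> (v # zs) + e)"
      by (intro ennreal_leI) simp
    also have "\<dots> = ennreal (polygon_length \<gamma> (filter (\<lambda>t. t \<le> u) ts @ [u])) + ennreal (polygon_length \<gamma> (v # zs)) + ennreal e"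
      using \<open>0 < e\<close> by (simp flip: ennreal_plus)
    also have "\<dots> \<le> path_length_on \<gamma> a u + path_length_on \<gamma> v b + ennreal e"
      using ts(1,2) uv unfolding zs_def
      by (intro add_mono polygon_length_le_path_length_on) (auto simp: sorted_append sorted_wrt_filter)
    finally have "path_length_on \<gamma> a b \<le> path_length_on \<gamma> a u + path_length_on \<gamma> v b + ennreal e"
      unfolding L .
    moreover have "path_length_on \<gamma> a b = path_length_on \<gamma> a u + path_length_on \<gamma> v b + path_length_on \<gamma> u v"
      using uv path_length_on_add[of a u b \<gamma>] path_length_on_add[of u v b \<gamma>] by (simp add: add_ac)
    moreover have "path_length_on \<gamma> a u + path_length_on \<gamma> v b \<noteq> top"
      using calculation(2) fin by auto
    ultimately show "path_length_on \<gamma> u v \<le> ennreal e"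
      by (metis ennreal_add_left_cancel_le top.not_eq_extremum infinity_ennreal_def)
  qed
qed

section \<open>Line integrals along subpaths\<close>

text \<open>Meaningful for finite lengths only, since \<open>enn2real\<close> sends infinity to
  0.\<close>

definition length_fun :: "(real \<Rightarrow> 'a::metric_space) \<Rightarrow> real \<Rightarrow> real" where
  "length_fun \<gamma> t = enn2real (path_length_on \<gamma> 0 t)"

lemma length_fun_0 [simp]: "length_fun \<gamma> 0 = 0"
  by (simp add: length_fun_def)

lemma rectifiable_path_length_on_finite:
  assumes "rectifiable_path \<gamma>" "0 \<le> u" "v \<le> 1"
  shows "path_length_on \<gamma> u v < \<infinity>"
  using path_length_on_mono[of 0 u v 1 \<gamma>] assms
  by (auto simp: rectifiable_path_def intro: le_less_trans)

lemma path_length_on_eq_length_fun: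
  assumes "rectifiable_path \<gamma>" "0 \<le> u" "u \<le> v" "v \<le> 1"
  shows "path_length_on \<gamma> u v = ennreal (length_fun \<gamma> v - length_fun \<gamma> u)"
    and "length_fun \<gamma> u \<le> length_fun \<gamma> v"
proof -
  have fin: "path_length_on \<gamma> 0 u < \<infinity>" "path_length_on \<gamma> u v < \<infinity>"
    using assms rectifiable_path_length_on_finite[of \<gamma> 0 u] rectifiable_path_length_on_finite[of \<gamma> u v]
    by auto
  have "path_length_on \<gamma> 0 v = path_length_on \<gamma> 0 u + path_length_on \<gamma> u v"
    using assms by (intro path_length_on_add) auto
  then have eq: "length_fun \<gamma> v = length_fun \<gamma> u + enn2real (path_length_on \<gamma> u v)"
    using fin unfolding length_fun_def by (simp add: enn2real_plus)
  show "path_length_on \<gamma> u v = ennreal (length_fun \<gamma> v - length_fun \<gamma> u)"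
    using fin unfolding eq by simp
  show "length_fun \<gamma> u \<le> length_fun \<gamma> v"
    unfolding eq by simp
qed

text \<open>The normal representation rests on this estimate: it makes \<gamma> constant wherever
  the length function is, and the arc length parametrization 1-Lipschitz.\<close>

lemma dist_le_length_fun:
  assumes "rectifiable_path \<gamma>" "u \<in> {0..1}" "v \<in> {0..1}"
  shows "dist (\<gamma> u) (\<gamma> v) \<le> \<bar>length_fun \<gamma> u - length_fun \<gamma> v\<bar>"
proof -
  have *: "dist (\<gamma> u) (\<gamma> v) \<le> length_fun \<gamma> v - length_fun \<gamma> u"
    if "0 \<le> u" "u \<le> v" "v \<le> 1" for u v
    using dist_le_path_length_on[of u v \<gamma>] path_length_on_eq_length_fun[OF assms(1) that] that
    by simp
  show ?thesis
    using *[of u v] *[of v u] assms by (cases "u \<le> v") (auto simp: dist_commute)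
qed

lemma continuous_on_length_fun:
  assumes "rectifiable_path \<gamma>"
  shows "continuous_on {0..1} (length_fun \<gamma>)"
  unfolding continuous_on_iff
proof (intro ballI allI impI)
  fix t e :: real assume t: "t \<in> {0..1}" and "0 < e"
  have "continuous_on {0..1} \<gamma>" "path_length_on \<gamma> 0 1 < \<infinity>"
    using assms by (auto simp: rectifiable_path_def path_def)
  then obtain d where "d > 0"
    and d: "\<And>u v. 0 \<le> u \<Longrightarrow> u \<le> v \<Longrightarrow> v \<le> 1 \<Longrightarrow> v - u < d \<Longrightarrow> path_length_on \<gamma> u v \<le> ennreal (e / 2)"
    using path_length_on_small[of 0 1 \<gamma> "e / 2"] \<open>0 < e\<close> by auto
  have *: "length_fun \<gamma> u \<le> length_fun \<gamma> v \<and> length_fun \<gamma> v - length_fun \<gamma> u \<le> e / 2"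
    if "0 \<le> u" "u \<le> v" "v \<le> 1" "v - u < d" for u v
    using d[OF that] path_length_on_eq_length_fun[OF assms that(1-3)] \<open>0 < e\<close>
    by (simp add: ennreal_le_iff)
  have "dist (length_fun \<gamma> s) (length_fun \<gamma> t) < e" if "s \<in> {0..1}" "dist s t < d" for s
    using *[of s t] *[of t s] that t \<open>0 < e\<close> by (cases "s \<le> t") (auto simp: dist_real_def)
  then show "\<exists>d>0. \<forall>s\<in>{0..1}. dist s t < d \<longrightarrow> dist (length_fun \<gamma> s) (length_fun \<gamma> t) < e"
    using \<open>d > 0\<close> by blast
qed

lemma length_fun_surj:
  assumes "rectifiable_path \<gamma>" "s \<in> {0..length_fun \<gamma> 1}"
  obtains t where "t \<in> {0..1}" "length_fun \<gamma> t = s"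
  using IVT'[of "length_fun \<gamma>" 0 s 1] continuous_on_length_fun[OF assms(1)] assms(2) by auto

text \<open>The parameter picked by \<open>SOME\<close> may differ from t, but it has the same
  length value, and \<open>dist_le_length_fun\<close> then forces the same point.\<close>

lemma arclength_param_length_fun:
  assumes "rectifiable_path \<gamma>" "t \<in> {0..1}"
  shows "arclength_param \<gamma> (length_fun \<gamma> t) = \<gamma> t"
proof -
  define t' where "t' = (SOME t'. t' \<in> {0..1} \<and> path_length_on \<gamma> 0 t' = ennreal (length_fun \<gamma> t))"
  have "t' \<in> {0..1} \<and> path_length_on \<gamma> 0 t' = ennreal (length_fun \<gamma> t)"
    unfolding t'_def
    by (rule someI[of _ t]) (use assms path_length_on_eq_length_fun[of \<gamma> 0 t] in auto)
  then have "t' \<in> {0..1}" "length_fun \<gamma> t' = length_fun \<gamma> t"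
    by (auto simp: length_fun_def)
  then have "\<gamma> t' = \<gamma> t"
    using dist_le_length_fun[OF assms(1) _ assms(2), of t'] by simp
  then show ?thesis
    by (simp add: arclength_param_def t'_def)
qed

lemma dist_arclength_param_le:
  assumes "rectifiable_path \<gamma>" "s \<in> {0..length_fun \<gamma> 1}" "s' \<in> {0..length_fun \<gamma> 1}"
  shows "dist (arclength_param \<gamma> s) (arclength_param \<gamma> s') \<le> \<bar>s - s'\<bar>"
  using assms arclength_param_length_fun[OF assms(1)] dist_le_length_fun[OF assms(1)]
    length_fun_surj[OF assms(1,2)] length_fun_surj[OF assms(1,3)] by metis

text \<open>Beyond the total length the choice in \<open>arclength_param\<close> is arbitrary, hence
  the indicator; inside, continuity of the parametrization gives measurability.\<close>

lemma measurable_arclength_param: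
  fixes \<rho> :: "'a::metric_space \<Rightarrow> ennreal"
  assumes "rectifiable_path \<gamma>" and [measurable]: "\<rho> \<in> borel_measurable borel"
    and "0 \<le> a" "b \<le> length_fun \<gamma> 1"
  shows "(\<lambda>s. \<rho> (arclength_param \<gamma> s) * indicator {a..b} s) \<in> borel_measurable borel"
proof -
  have "continuous_on {a..b} (arclength_param \<gamma>)"
    unfolding continuous_on_iff
  proof (intro ballI allI impI)
    fix s e :: real assume "s \<in> {a..b}" "0 < e"
    then have "dist (arclength_param \<gamma> s') (arclength_param \<gamma> s) < e"
      if "s' \<in> {a..b}" "dist s' s < e" for s'
      using dist_arclength_param_le[OF assms(1), of s' s] that assms(3,4)
      by (auto simp: dist_real_def)
    with \<open>0 < e\<close> show "\<exists>d>0. \<forall>s'\<in>{a..b}. dist s' s < d \<longrightarrow> dist (arclength_param \<gamma> s') (arclength_param \<gamma> s) < e"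
      by blast
  qed
  then have [measurable]: "arclength_param \<gamma> \<in> borel_measurable (restrict_space borel {a..b})"
    by (rule borel_measurable_continuous_on_restrict)
  have "(\<lambda>s. \<rho> (arclength_param \<gamma> s)) \<in> borel_measurable (restrict_space borel {a..b})"
    by measurable
  then show ?thesis
    by (subst (asm) borel_measurable_restrict_space_iff_ennreal) auto
qed

lemma line_integral_eq:
  "line_integral \<rho> \<gamma> = (\<integral>\<^sup>+s\<in>{0..length_fun \<gamma> 1}. \<rho> (arclength_param \<gamma> s) \<partial>lborel)"
  by (simp add: line_integral_def length_fun_def)

lemma path_length_on_subpath:
  assumes "u < v"
  shows "path_length_on (subpath u v \<gamma>) a b = path_length_on \<gamma> (u + (v - u) * a) (u + (v - u) * b)"
  using path_length_on_affine[of "v - u" \<gamma> u a b] assms by (simp add: subpath_def add.commute)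

lemma rectifiable_path_subpath:
  assumes "rectifiable_path \<gamma>" "0 \<le> u" "u < v" "v \<le> 1"
  shows "rectifiable_path (subpath u v \<gamma>)"
proof -
  have "path (subpath u v \<gamma>)"
    using assms by (intro path_subpath) (auto simp: rectifiable_path_def)
  moreover have "path_length_on (subpath u v \<gamma>) 0 1 < \<infinity>"
    using path_length_on_subpath[OF assms(3), of \<gamma> 0 1] rectifiable_path_length_on_finite[of \<gamma> u v] assms
    by simp
  ultimately show ?thesis by (simp add: rectifiable_path_def)
qed

lemma length_fun_subpath:
  assumes "rectifiable_path \<gamma>" "0 \<le> u" "u < v" "v \<le> 1" "t \<in> {0..1}"
  shows "length_fun (subpath u v \<gamma>) t = length_fun \<gamma> (u + (v - u) * t) - length_fun \<gamma> u"
proof -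
  have *: "u \<le> u + (v - u) * t" "u + (v - u) * t \<le> 1"
    using convex_bound_le[of u 1 v "1 - t" t] mult_left_mono[of u v t] assms by (auto simp: algebra_simps)
  show ?thesis
    using path_length_on_eq_length_fun[OF assms(1,2) *] path_length_on_subpath[OF assms(3), of \<gamma> 0 t]
    by (simp add: length_fun_def)
qed

text \<open>The normal representation of a subpath is that of \<gamma> shifted by
  \<open>length_fun \<gamma> u\<close>, so a translation of the integral suffices.\<close>

lemma line_integral_subpath:
  fixes \<rho> :: "'a::real_normed_vector \<Rightarrow> ennreal"
  assumes "rectifiable_path \<gamma>" "\<rho> \<in> borel_measurable borel" "0 \<le> u" "u < v" "v \<le> 1"
  shows "line_integral \<rho> (subpath u v \<gamma>)
       = (\<integral>\<^sup>+s\<in>{length_fun \<gamma> u..length_fun \<gamma> v}. \<rho> (arclength_param \<gamma> s) \<partial>lborel)"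
proof -
  let ?l = "length_fun \<gamma>" and ?\<gamma>' = "subpath u v \<gamma>"
  have rect: "rectifiable_path ?\<gamma>'"
    by (rule rectifiable_path_subpath) (use assms in auto)
  have mono: "0 \<le> ?l u" "?l u \<le> ?l v" "?l v \<le> ?l 1"
    using path_length_on_eq_length_fun(2)[OF assms(1), of 0 u] path_length_on_eq_length_fun(2)[OF assms(1), of u v]
      path_length_on_eq_length_fun(2)[OF assms(1), of v 1] assms by auto
  have L: "length_fun ?\<gamma>' 1 = ?l v - ?l u"
    using length_fun_subpath[OF assms(1,3-5), of 1] by simp
  have param: "arclength_param ?\<gamma>' s = arclength_param \<gamma> (?l u + s)" if s: "s \<in> {0..?l v - ?l u}" for s
  proof -
    obtain t where t: "t \<in> {0..1}" "length_fun ?\<gamma>' t = s"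
      using length_fun_surj[OF rect] s L by metis
    have *: "0 \<le> u + (v - u) * t" "u + (v - u) * t \<le> 1"
      using convex_bound_le[of u 1 v "1 - t" t] mult_left_mono[of u v t] assms t by (auto simp: algebra_simps)
    have "arclength_param ?\<gamma>' s = ?\<gamma>' t"
      using arclength_param_length_fun[OF rect t(1)] t(2) by simp
    also have "\<dots> = \<gamma> (u + (v - u) * t)"
      by (simp add: subpath_def add.commute)
    also have "\<dots> = arclength_param \<gamma> (?l (u + (v - u) * t))"
      using arclength_param_length_fun[OF assms(1)] * by simp
    also have "?l (u + (v - u) * t) = ?l u + s"
      using length_fun_subpath[OF assms(1,3-5) t(1)] t(2) by simp
    finally show ?thesis .
  qed
  have "(\<integral>\<^sup>+s\<in>{?l u..?l v}. \<rho> (arclength_param \<gamma> s) \<partial>lborel)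
      = (\<integral>\<^sup>+s. \<rho> (arclength_param \<gamma> (?l u + s)) * indicator {?l u..?l v} (?l u + s) \<partial>lborel)"
    using mono assms(1,2)
    by (subst nn_integral_real_affine[where c = 1 and t = "?l u"]) (auto intro!: measurable_arclength_param)
  also have "\<dots> = (\<integral>\<^sup>+s\<in>{0..length_fun ?\<gamma>' 1}. \<rho> (arclength_param ?\<gamma>' s) \<partial>lborel)"
    unfolding L by (intro nn_integral_cong) (auto simp: param indicator_def)
  finally show ?thesis
    by (simp add: line_integral_eq)
qed

lemma line_integral_subpath_le:
  fixes \<rho> :: "'a::real_normed_vector \<Rightarrow> ennreal"
  assumes "rectifiable_path \<gamma>" "\<rho> \<in> borel_measurable borel" "0 \<le> u" "u < v" "v \<le> 1"
  shows "line_integral \<rho> (subpath u v \<gamma>) \<le> line_integral \<rho> \<gamma>"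
  unfolding line_integral_subpath[OF assms] line_integral_eq[of \<rho> \<gamma>]
  using path_length_on_eq_length_fun(2)[OF assms(1), of 0 u] path_length_on_eq_length_fun(2)[OF assms(1), of v 1] assms
  by (intro nn_integral_mono) (auto simp: indicator_def)

lemma line_integral_le_subpaths:
  fixes \<rho> :: "'a::real_normed_vector \<Rightarrow> ennreal"
  assumes "rectifiable_path \<gamma>" "\<rho> \<in> borel_measurable borel" "0 < u" "u < 1"
  shows "line_integral \<rho> \<gamma> \<le> line_integral \<rho> (subpath 0 u \<gamma>) + line_integral \<rho> (subpath u 1 \<gamma>)"
proof -
  let ?l = "length_fun \<gamma>"
  have "0 \<le> ?l u" "?l u \<le> ?l 1"
    using path_length_on_eq_length_fun(2)[OF assms(1), of 0 u] path_length_on_eq_length_fun(2)[OF assms(1), of u 1]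
      assms by auto
  then have "line_integral \<rho> (subpath 0 u \<gamma>) + line_integral \<rho> (subpath u 1 \<gamma>)
      = (\<integral>\<^sup>+s. \<rho> (arclength_param \<gamma> s) * indicator {0..?l u} s
            + \<rho> (arclength_param \<gamma> s) * indicator {?l u..?l 1} s \<partial>lborel)"
    using assms
    by (subst nn_integral_add) (auto simp: line_integral_subpath intro!: measurable_arclength_param)
  also have "\<dots> \<ge> line_integral \<rho> \<gamma>"
    unfolding line_integral_eq by (intro nn_integral_mono) (auto simp: indicator_def)
  finally show ?thesis .
qed

text \<open>Paths are functions on the whole line of which only the unit interval counts. A path
  that is pulled back and pushed forward by inverse homeomorphisms is recovered on that interval
  only.\<close>

lemma line_integral_cong:
  assumes "rectifiable_path \<gamma>" "\<And>t. t \<in> {0..1} \<Longrightarrow> \<gamma> t = \<gamma>' t"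
  shows "rectifiable_path \<gamma>'" "line_integral \<rho> \<gamma> = line_integral \<rho> \<gamma>'"
proof -
  have eq: "path_length_on \<gamma> 0 t = path_length_on \<gamma>' 0 t" if "t \<in> {0..1}" for t
    using that by (intro path_length_on_cong assms(2)) auto
  then have l: "length_fun \<gamma> t = length_fun \<gamma>' t" if "t \<in> {0..1}" for t
    using that by (simp add: length_fun_def)
  have "path \<gamma>'"
    using assms unfolding rectifiable_path_def path_def by (metis continuous_on_eq)
  then show rect: "rectifiable_path \<gamma>'"
    using assms eq[of 1] unfolding rectifiable_path_def by auto
  have param: "arclength_param \<gamma> s = arclength_param \<gamma>' s" if s: "s \<in> {0..length_fun \<gamma>' 1}" for s
  proof -
    obtain t where t: "t \<in> {0..1}" "length_fun \<gamma>' t = s"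
      using length_fun_surj[OF rect s] by metis
    then show ?thesis
      using arclength_param_length_fun[OF rect t(1)] arclength_param_length_fun[OF assms(1) t(1)]
        l[OF t(1)] assms(2)[OF t(1)] by simp
  qed
  have "length_fun \<gamma> 1 = length_fun \<gamma>' 1"
    by (rule l) simp
  then show "line_integral \<rho> \<gamma> = line_integral \<rho> \<gamma>'"
    unfolding line_integral_eq by (intro nn_integral_cong) (auto simp: param indicator_def)
qed

lemma line_integral_joinpaths_le:
  fixes \<rho> :: "'a::real_normed_vector \<Rightarrow> ennreal"
  assumes "rectifiable_path g1" "rectifiable_path g2" "pathfinish g1 = pathstart g2"
    and "\<rho> \<in> borel_measurable borel"
  shows "rectifiable_path (g1 +++ g2)"
    and "line_integral \<rho> (g1 +++ g2) \<le> line_integral \<rho> g1 + line_integral \<rho> g2"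
proof -
  let ?J = "g1 +++ g2"
  have 1: "g1 t = subpath 0 (1/2) ?J t" if "t \<in> {0..1}" for t
    using that by (auto simp: subpath_def joinpaths_def)
  have 2: "g2 t = subpath (1/2) 1 ?J t" if "t \<in> {0..1}" for t
  \<comment> \<open>At t = 0 the joined path is evaluated at 1/2, where the first branch of
    \<open>joinpaths\<close> applies; the end point condition identifies the two values.\<close>
  proof (cases "t = 0")
    case True
    then show ?thesis
      using assms(3) by (simp add: subpath_def joinpaths_def pathfinish_def pathstart_def)
  next
    case False
    then show ?thesis
      using that by (auto simp: subpath_def joinpaths_def field_simps)
  qed
  have "path_length_on ?J 0 1 = path_length_on ?J 0 (1/2) + path_length_on ?J (1/2) 1"
    by (rule path_length_on_add) auto
  also have "path_length_on ?J 0 (1/2) = path_length_on g1 0 1"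
    using path_length_on_subpath[of 0 "1/2" ?J 0 1] path_length_on_cong[of 0 1, OF 1] by simp
  also have "path_length_on ?J (1/2) 1 = path_length_on g2 0 1"
    using path_length_on_subpath[of "1/2" 1 ?J 0 1] path_length_on_cong[of 0 1, OF 2] by simp
  finally show rect: "rectifiable_path ?J"
    using assms by (auto simp: rectifiable_path_def)
  show "line_integral \<rho> ?J \<le> line_integral \<rho> g1 + line_integral \<rho> g2"
    using line_integral_le_subpaths[OF rect assms(4), of "1/2"]
      line_integral_cong(2)[OF assms(1) 1, of \<rho>] line_integral_cong(2)[OF assms(2) 2, of \<rho>] by simp
qed

lemma path_length_on_linepath:
  fixes a b :: "'a::real_normed_vector"
  assumes "u \<le> v"
  shows "path_length_on (linepath a b) u v = ennreal ((v - u) * dist a b)"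
proof (rule antisym)
  have d: "dist (linepath a b s) (linepath a b t) = \<bar>s - t\<bar> * dist a b" for s t
  proof -
    have "linepath a b s - linepath a b t = (s - t) *\<^sub>R (b - a)"
      by (simp add: linepath_def algebra_simps)
    then show ?thesis
      by (simp add: dist_norm norm_minus_commute)
  qed
  \<comment> \<open>Measuring from the first node t up to the fixed end v makes the list induction
    telescope.\<close>
  have *: "polygon_length (linepath a b) (t # ts) \<le> (v - t) * dist a b"
    if "sorted (t # ts)" "set (t # ts) \<subseteq> {..v}" for t ts
    using that
  proof (induction ts arbitrary: t)
    case (Cons s ts)
    then have "polygon_length (linepath a b) (s # ts) \<le> (v - s) * dist a b" by simp
    then show ?case
      using Cons.prems by (simp add: d algebra_simps)
  qed (simp add: mult_nonneg_nonneg)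
  show "path_length_on (linepath a b) u v \<le> ennreal ((v - u) * dist a b)"
    unfolding path_length_on_eq
  proof (rule SUP_least, clarify)
    fix ts assume ts: "sorted ts" "set ts \<subseteq> {u..v}"
    show "ennreal (polygon_length (linepath a b) ts) \<le> ennreal ((v - u) * dist a b)"
    proof (cases ts)
      case (Cons t ts')
      have "polygon_length (linepath a b) ts \<le> (v - t) * dist a b"
        unfolding Cons by (rule *) (use ts Cons in auto)
      also have "\<dots> \<le> (v - u) * dist a b"
        using ts Cons by (intro mult_right_mono) auto
      finally show ?thesis by (rule ennreal_leI)
    qed simp
  qed
  show "ennreal ((v - u) * dist a b) \<le> path_length_on (linepath a b) u v"
    using dist_le_path_length_on[OF assms, of "linepath a b"] assms by (simp add: d)
qed

lemma rectifiable_path_linepath [simp]: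
  fixes a b :: "'a::real_normed_vector"
  shows "rectifiable_path (linepath a b)"
  by (simp add: rectifiable_path_def path_length_on_linepath)

lemma line_integral_linepath:
  fixes a b :: "'a::real_normed_vector"
  assumes "\<rho> \<in> borel_measurable borel"
  shows "line_integral \<rho> (linepath a b)
       = ennreal (dist a b) * (\<integral>\<^sup>+t\<in>{0..1}. \<rho> (linepath a b t) \<partial>lborel)"
proof -
  let ?\<gamma> = "linepath a b" and ?D = "dist a b"
  have l: "length_fun ?\<gamma> t = t * ?D" if "0 \<le> t" for t
    using that by (simp add: length_fun_def path_length_on_linepath)
  show ?thesis
  proof (cases "a = b")
    case True
    have "{0..length_fun ?\<gamma> 1} = {0}"
      using l[of 1] True by simp
    then show ?thesis
      using True by (simp add: line_integral_eq nn_integral_cmult_indicator)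
  next
    case False
    have param: "arclength_param ?\<gamma> (t * ?D) = ?\<gamma> t" if "t \<in> {0..1}" for t
      using arclength_param_length_fun[OF rectifiable_path_linepath that, of a b] l[of t] that by simp
    have "line_integral \<rho> ?\<gamma> = ennreal ?D * (\<integral>\<^sup>+t. \<rho> (arclength_param ?\<gamma> (?D * t)) * indicator {0..?D} (?D * t) \<partial>lborel)"
      unfolding line_integral_eq using False assms l[of 1]
      by (subst nn_integral_real_affine[where c = ?D and t = 0]) (auto intro!: measurable_arclength_param)
    also have "(\<integral>\<^sup>+t. \<rho> (arclength_param ?\<gamma> (?D * t)) * indicator {0..?D} (?D * t) \<partial>lborel)
        = (\<integral>\<^sup>+t\<in>{0..1}. \<rho> (?\<gamma> t) \<partial>lborel)"
      using False param
      by (intro nn_integral_cong) (auto simp: indicator_def mult.commute zero_le_mult_iff)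
    finally show ?thesis .
  qed
qed

text \<open>A density admissible for \<open>\<Gamma>2\<close> is admissible for
  \<open>\<Gamma>1\<close>, because a curve has at least the line integral of its subcurve. This is
  the comparison principle for families minorized by one another.\<close>

lemma modulus_le_modulus_subpath:
  fixes \<Gamma>1 \<Gamma>2 :: "(real \<Rightarrow> real^'n) set"
  assumes "\<And>\<gamma>. \<gamma> \<in> \<Gamma>1 \<Longrightarrow>
    \<exists>u v. 0 \<le> u \<and> u < v \<and> v \<le> 1 \<and> (\<exists>\<gamma>'\<in>\<Gamma>2. \<forall>t\<in>{0..1}. subpath u v \<gamma> t = \<gamma>' t)"
  shows "modulus \<Gamma>1 \<le> modulus \<Gamma>2"
  unfolding modulus_def
proof (rule INF_superset_mono)
  show "admissible \<Gamma>2 \<subseteq> admissible \<Gamma>1"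
  proof
    fix \<rho> assume "\<rho> \<in> admissible \<Gamma>2"
    then have \<rho>: "\<rho> \<in> borel_measurable borel"
      "\<And>\<gamma>. \<gamma> \<in> \<Gamma>2 \<Longrightarrow> rectifiable_path \<gamma> \<Longrightarrow> line_integral \<rho> \<gamma> \<ge> 1"
      by (auto simp: admissible_def)
    have "line_integral \<rho> \<gamma> \<ge> 1" if \<gamma>: "\<gamma> \<in> \<Gamma>1" "rectifiable_path \<gamma>" for \<gamma>
    proof -
      obtain u v \<gamma>' where uv: "0 \<le> u" "u < v" "v \<le> 1"
        and \<gamma>': "\<gamma>' \<in> \<Gamma>2" "\<And>t. t \<in> {0..1} \<Longrightarrow> subpath u v \<gamma> t = \<gamma>' t"
        using assms[OF \<gamma>(1)] by blast
      have rect: "rectifiable_path (subpath u v \<gamma>)"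
        by (rule rectifiable_path_subpath[OF \<gamma>(2) uv])
      have "1 \<le> line_integral \<rho> \<gamma>'"
        by (rule \<rho>(2)[OF \<gamma>'(1) line_integral_cong(1)[OF rect \<gamma>'(2)]])
      also have "\<dots> = line_integral \<rho> (subpath u v \<gamma>)"
        by (rule line_integral_cong(2)[OF rect \<gamma>'(2), symmetric])
      also have "\<dots> \<le> line_integral \<rho> \<gamma>"
        by (rule line_integral_subpath_le[OF \<gamma>(2) \<rho>(1) uv])
      finally show ?thesis .
    qed
    with \<rho>(1) show "\<rho> \<in> admissible \<Gamma>1"
      by (auto simp: admissible_def)
  qed
qed simp

section \<open>Segments issuing from a curve\<close>

text \<open>Bernoulli's inequality for x / c, multiplied by c. Equality holds at x = c, so after
  integration the choice of c decides how sharp the resulting estimate is.\<close>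

lemma young_ennreal:
  fixes x :: ennreal
  assumes "0 < c" "0 < N"
  shows "of_nat N * x \<le> x ^ N * ennreal (1 / c ^ (N - 1)) + ennreal ((real N - 1) * c)"
proof (cases x)
  case (real r)
  have "1 + real N * (r / c - 1) \<le> (r / c) ^ N"
    using Bernoulli_inequality[of "r / c - 1" N] real assms by simp
  then have "(1 + real N * (r / c - 1)) * c \<le> (r / c) ^ N * c"
    using assms by (intro mult_right_mono) auto
  also have "(r / c) ^ N * c = r ^ N * (1 / c ^ (N - 1))"
    using assms by (cases N) (auto simp: power_divide field_simps)
  finally have "real N * r \<le> r ^ N * (1 / c ^ (N - 1)) + (real N - 1) * c"
    using assms by (simp add: algebra_simps)
  then have "ennreal (real N * r) \<le> ennreal (r ^ N * (1 / c ^ (N - 1)) + (real N - 1) * c)"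
    by (rule ennreal_leI)
  also have "\<dots> = x ^ N * ennreal (1 / c ^ (N - 1)) + ennreal ((real N - 1) * c)"
    using real assms by (simp add: ennreal_plus ennreal_mult ennreal_power del: times_divide_eq_right mult_1_right)
  finally show ?thesis
    using real by (simp add: ennreal_mult ennreal_of_nat_eq_real_of_nat)
next
  case top
  then show ?thesis
    using assms by (simp add: ennreal_top_mult ennreal_mult_top power_eq_top_ennreal)
qed

lemma nn_integral_lborel_scale:
  fixes h :: "'a::euclidean_space \<Rightarrow> ennreal"
  assumes [measurable]: "h \<in> borel_measurable borel" and "0 < c"
  shows "(\<integral>\<^sup>+z. h (b + c *\<^sub>R z) \<partial>lborel) = ennreal (1 / c ^ DIM('a)) * (\<integral>\<^sup>+w. h w \<partial>lborel)"
proof -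
  have "(\<integral>\<^sup>+w. h w \<partial>lborel) = (\<integral>\<^sup>+z. ennreal (c ^ DIM('a)) * h (b + c *\<^sub>R z) \<partial>lborel)"
    using assms(2)
    by (subst lborel_affine[of c b]) (auto simp: nn_integral_density nn_integral_distr)
  also have "\<dots> = ennreal (c ^ DIM('a)) * (\<integral>\<^sup>+z. h (b + c *\<^sub>R z) \<partial>lborel)"
    by (rule nn_integral_cmult) measurable
  finally show ?thesis
    using assms(2) by (simp add: mult.assoc[symmetric] flip: ennreal_mult)
qed

lemma nn_integral_powr_from_0:
  assumes "0 < N"
  shows "(\<integral>\<^sup>+t\<in>{0<..1}. ennreal (t powr (1 / real N - 1)) \<partial>lborel) = ennreal (real N)"
proof -
  have "((\<lambda>t. t powr (1 / real N - 1)) has_integral (1 powr (1 / real N - 1 + 1) / (1 / real N - 1 + 1))) {0..1}"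
    using assms by (intro has_integral_powr_from_0) auto
  then have "((\<lambda>t. t powr (1 / real N - 1)) has_integral real N) {0..1}"
    using assms by simp
  then have "(\<integral>\<^sup>+t. indicator {0..1} t * ennreal (t powr (1 / real N - 1)) \<partial>lborel) = ennreal (real N)"
    using nn_integral_has_integral_lebesgue[of "{0..1}" "\<lambda>t. t powr (1 / real N - 1)"]
    by (simp add: ennreal_mult' ennreal_indicator)
  also have "(\<integral>\<^sup>+t. indicator {0..1} t * ennreal (t powr (1 / real N - 1)) \<partial>lborel)
      = (\<integral>\<^sup>+t\<in>{0<..1}. ennreal (t powr (1 / real N - 1)) \<partial>lborel)"
    by (intro nn_integral_cong) (auto simp: indicator_def)
  finally show ?thesis .
qed

lemma emeasure_annulus:
  fixes a :: "'a::euclidean_space"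
  assumes "0 < R"
  shows "emeasure lborel (annulus a R (2 * R)) = ennreal (unit_ball_vol DIM('a) * (2 ^ DIM('a) - 1) * R ^ DIM('a))"
proof -
  have "annulus a R (2 * R) = ball a (2 * R) - cball a R"
    by (auto simp: annulus_def dist_commute)
  then have "emeasure lborel (annulus a R (2 * R)) = emeasure lborel (ball a (2 * R)) - emeasure lborel (cball a R)"
    using assms emeasure_lborel_cball_finite[of a R] by (simp add: emeasure_Diff cball_subset_ball_iff)
  also have "\<dots> = ennreal (unit_ball_vol DIM('a) * (2 ^ DIM('a) - 1) * R ^ DIM('a))"
    using assms by (simp add: emeasure_ball emeasure_cball ennreal_minus algebra_simps power_mult_distrib)
  finally show ?thesis .
qed

lemma annulus_measurable [measurable]: "annulus a r s \<in> sets borel"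
proof -
  have "annulus a r s = ball a s - cball a r"
    by (auto simp: annulus_def dist_commute)
  then show ?thesis by simp
qed

lemma borel_measurable_linepath [measurable (raw)]:
  fixes f g :: "'b \<Rightarrow> 'a::{real_normed_vector, second_countable_topology}"
  assumes "f \<in> borel_measurable M" "g \<in> borel_measurable M" "h \<in> borel_measurable M"
  shows "(\<lambda>x. linepath (f x) (g x) (h x)) \<in> borel_measurable M"
  using assms unfolding linepath_def by measurable

text \<open>For fixed \<tau> the substitution \<open>w = linepath (p t) z \<tau>\<close> scales
  volume by \<tau> to the power of the dimension and moves the annulus into the ball of radius
  \<open>3 * R * \<tau>\<close> about p t: at most R from p t to a and 2 R from a to z. Conversely,
  w is that close to p t only for t in an interval of length \<open>6 * R * \<tau> / e\<close>,
  because the component of p t along u moves at speed e. Exchanging the integrals therefore regains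
  one power of \<tau>.\<close>

lemma nn_integral_curve_slice:
  fixes p :: "real \<Rightarrow> 'a::euclidean_space" and \<rho> :: "'a \<Rightarrow> ennreal"
  assumes [measurable]: "\<rho> \<in> borel_measurable borel" "p \<in> borel_measurable borel"
    and \<rho>: "(\<integral>\<^sup>+w. \<rho> w ^ DIM('a) \<partial>lborel) \<le> ennreal M" "0 \<le> M"
    and "0 < R" "0 < e"
    and u: "norm u = 1" "\<And>t. t \<in> {0..1} \<Longrightarrow> p t \<bullet> u = b + t * e"
    and a: "\<And>t. t \<in> {0..1} \<Longrightarrow> dist (p t) a \<le> R"
    and "0 < \<tau>" "\<tau> \<le> 1"
  shows "(\<integral>\<^sup>+t\<in>{0..1}. (\<integral>\<^sup>+z\<in>annulus a R (2 * R). \<rho> (linepath (p t) z \<tau>) ^ DIM('a) \<partial>lborel) \<partial>lborel)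
       \<le> ennreal (6 * R / e * M / \<tau> ^ (DIM('a) - 1))"
proof -
  define N where "N = DIM('a)"
  have N: "0 < N" by (simp add: N_def)
  define h where "h t w = \<rho> w ^ N * (if dist w (p t) \<le> 3 * R * \<tau> \<and> t \<in> {0..1} then 1 else 0 :: ennreal)" for t w
  have [measurable]: "h t \<in> borel_measurable borel" for t
    unfolding h_def by measurable
  have inner: "(\<integral>\<^sup>+z\<in>annulus a R (2 * R). \<rho> (linepath (p t) z \<tau>) ^ N \<partial>lborel)
      \<le> ennreal (1 / \<tau> ^ N) * (\<integral>\<^sup>+w. h t w \<partial>lborel)" if t: "t \<in> {0..1}" for t
  proof -
    have "dist ((1 - \<tau>) *\<^sub>R p t + \<tau> *\<^sub>R z) (p t) \<le> 3 * R * \<tau>" if "z \<in> annulus a R (2 * R)" for z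
    proof -
      have "(1 - \<tau>) *\<^sub>R p t + \<tau> *\<^sub>R z - p t = \<tau> *\<^sub>R (z - p t)"
        by (simp add: algebra_simps)
      then have "dist ((1 - \<tau>) *\<^sub>R p t + \<tau> *\<^sub>R z) (p t) = \<tau> * dist z (p t)"
        using \<open>0 < \<tau>\<close> by (simp add: dist_norm)
      also have "\<dots> \<le> \<tau> * (3 * R)"
        using a[OF t] that \<open>0 < \<tau>\<close> dist_triangle2[of z "p t" a]
        by (intro mult_left_mono) (auto simp: annulus_def)
      finally show ?thesis by (simp add: mult_ac)
    qed
    then have "(\<integral>\<^sup>+z\<in>annulus a R (2 * R). \<rho> (linepath (p t) z \<tau>) ^ N \<partial>lborel)
        \<le> (\<integral>\<^sup>+z. h t ((1 - \<tau>) *\<^sub>R p t + \<tau> *\<^sub>R z) \<partial>lborel)"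
      using t by (intro nn_integral_mono) (auto simp: h_def linepath_def indicator_def)
    also have "\<dots> = ennreal (1 / \<tau> ^ N) * (\<integral>\<^sup>+w. h t w \<partial>lborel)"
      unfolding N_def using \<open>0 < \<tau>\<close> by (intro nn_integral_lborel_scale) auto
    finally show ?thesis .
  qed
  have outer: "(\<integral>\<^sup>+t. h t w \<partial>lborel) \<le> \<rho> w ^ N * ennreal (6 * R * \<tau> / e)" for w
  proof -
    let ?c = "(w \<bullet> u - b) / e" and ?r = "3 * R * \<tau> / e"
    have "t \<in> {?c - ?r..?c + ?r}" if "dist w (p t) \<le> 3 * R * \<tau>" "t \<in> {0..1}" for t
    proof -
      have "\<bar>(w - p t) \<bullet> u\<bar> \<le> norm (w - p t) * norm u"
        by (rule Cauchy_Schwarz_ineq2)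
      then have "\<bar>w \<bullet> u - b - t * e\<bar> \<le> 3 * R * \<tau>"
        using that u by (simp add: dist_norm inner_diff_left)
      then show ?thesis
        using \<open>0 < e\<close> unfolding diff_divide_distrib[symmetric] add_divide_distrib[symmetric]
        by (simp add: pos_divide_le_eq pos_le_divide_eq abs_le_iff)
    qed
    then have "(\<integral>\<^sup>+t. h t w \<partial>lborel) \<le> (\<integral>\<^sup>+t. \<rho> w ^ N * indicator {?c - ?r..?c + ?r} t \<partial>lborel)"
      by (intro nn_integral_mono) (auto simp: h_def indicator_def)
    also have "\<dots> = \<rho> w ^ N * ennreal (6 * R * \<tau> / e)"
      using assms by (subst nn_integral_cmult_indicator) (auto simp: field_simps)
    finally show ?thesis .
  qed
  have "(\<integral>\<^sup>+t\<in>{0..1}. (\<integral>\<^sup>+z\<in>annulus a R (2 * R). \<rho> (linepath (p t) z \<tau>) ^ N \<partial>lborel) \<partial>lborel)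
      \<le> (\<integral>\<^sup>+t. ennreal (1 / \<tau> ^ N) * (\<integral>\<^sup>+w. h t w \<partial>lborel) \<partial>lborel)"
    using inner by (intro nn_integral_mono) (auto simp: indicator_def)
  also have "\<dots> = ennreal (1 / \<tau> ^ N) * (\<integral>\<^sup>+t. \<integral>\<^sup>+w. h t w \<partial>lborel \<partial>lborel)"
    unfolding h_def by (intro nn_integral_cmult) measurable
  also have "(\<integral>\<^sup>+t. \<integral>\<^sup>+w. h t w \<partial>lborel \<partial>lborel) = (\<integral>\<^sup>+w. \<integral>\<^sup>+t. h t w \<partial>lborel \<partial>lborel)"
    unfolding h_def by (intro lborel_pair.Fubini') measurable
  also have "ennreal (1 / \<tau> ^ N) * \<dots> \<le> ennreal (1 / \<tau> ^ N) * (\<integral>\<^sup>+w. \<rho> w ^ N * ennreal (6 * R * \<tau> / e) \<partial>lborel)"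
    by (intro mult_left_mono nn_integral_mono outer) auto
  also have "\<dots> = ennreal (1 / \<tau> ^ N) * ((\<integral>\<^sup>+w. \<rho> w ^ N \<partial>lborel) * ennreal (6 * R * \<tau> / e))"
    by (subst nn_integral_multc) auto
  also have "\<dots> \<le> ennreal (1 / \<tau> ^ N) * (ennreal M * ennreal (6 * R * \<tau> / e))"
    using \<rho> by (intro mult_left_mono mult_right_mono) (auto simp: N_def)
  also have "\<dots> = ennreal (1 / \<tau> ^ N * (M * (6 * R * \<tau> / e)))"
    using assms by (simp add: ennreal_mult del: times_divide_eq_right times_divide_eq_left)
  also have "1 / \<tau> ^ N * (M * (6 * R * \<tau> / e)) = 6 * R / e * M / \<tau> ^ (N - 1)"
    using N \<open>0 < \<tau>\<close> \<open>0 < e\<close> by (cases N) (auto simp: field_simps)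
  finally show ?thesis
    by (simp add: N_def)
qed

text \<open>Balancing the slice bound of order \<open>\<tau> powr (1 - N)\<close> by Young's
  inequality leaves the integrable singularity \<open>\<tau> powr (1 / N - 1)\<close>. Segments from
  a single point would have slices of order \<open>\<tau> powr (- N)\<close> and lead to the
  divergent 1 / \<tau>; this is the profit from the moving starting point p t.\<close>

lemma nn_integral_segments_to_curve:
  fixes p :: "real \<Rightarrow> 'a::euclidean_space" and \<rho> :: "'a \<Rightarrow> ennreal"
  assumes [measurable]: "\<rho> \<in> borel_measurable borel" "p \<in> borel_measurable borel"
    and \<rho>: "(\<integral>\<^sup>+w. \<rho> w ^ DIM('a) \<partial>lborel) \<le> ennreal (\<mu> ^ DIM('a))" "0 < \<mu>"
    and "0 < R" "0 < e"
    and u: "norm u = 1" "\<And>t. t \<in> {0..1} \<Longrightarrow> p t \<bullet> u = b + t * e"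
    and a: "\<And>t. t \<in> {0..1} \<Longrightarrow> dist (p t) a \<le> R"
  shows "(\<integral>\<^sup>+t\<in>{0..1}. (\<integral>\<^sup>+z\<in>annulus a R (2 * R).
            ennreal (dist (p t) z) * (\<integral>\<^sup>+\<tau>\<in>{0..1}. \<rho> (linepath (p t) z \<tau>) \<partial>lborel) \<partial>lborel) \<partial>lborel)
       \<le> ennreal (3 * (6 * R / e + (DIM('a) - 1) * (unit_ball_vol DIM('a) * (2 ^ DIM('a) - 1))) * \<mu> * R ^ DIM('a))"
proof -
  define N where "N = DIM('a)"
  have N: "0 < N" by (simp add: N_def)
  let ?A = "annulus a R (2 * R)"
  define V where "V = unit_ball_vol N * (2 ^ N - 1)"
  have V: "0 \<le> V" by (simp add: V_def)
  define G where "G t z \<tau> = \<rho> (linepath (p t) z \<tau>) * indicator {0<..1} \<tau> * indicator ?A z * indicator {0..1::real} t" for t z \<tau>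
  have slice: "of_nat N * (\<integral>\<^sup>+t. \<integral>\<^sup>+z. G t z \<tau> \<partial>lborel \<partial>lborel)
      \<le> ennreal ((6 * R / e + (N - 1) * V) * \<mu> * R ^ (N - 1)) * (ennreal (\<tau> powr (1 / real N - 1)) * indicator {0<..1} \<tau>)" for \<tau>
  proof (cases "\<tau> \<in> {0<..1}")
    case False
    then show ?thesis by (simp add: G_def)
  next
    case True
    \<comment> \<open>With this c both terms of Young's inequality become multiples of
      \<open>\<mu> * R ^ (N - 1) * \<tau> powr (1 / N - 1)\<close>.\<close>
    define c where "c = \<mu> / R * \<tau> powr (1 / real N - 1)"
    have c: "0 < c"
      using True \<open>0 < \<mu>\<close> \<open>0 < R\<close> by (simp add: c_def)
    let ?H = "\<lambda>t z. \<rho> (linepath (p t) z \<tau>) ^ N * indicator ?A z * indicator {0..1::real} t"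
    let ?I = "\<lambda>t z. indicator ?A z * indicator {0..1::real} t :: ennreal"
    have "of_nat N * (\<integral>\<^sup>+t. \<integral>\<^sup>+z. G t z \<tau> \<partial>lborel \<partial>lborel)
        = (\<integral>\<^sup>+t. \<integral>\<^sup>+z. of_nat N * G t z \<tau> \<partial>lborel \<partial>lborel)"
      by (simp add: nn_integral_cmult G_def)
    also have "\<dots> \<le> (\<integral>\<^sup>+t. \<integral>\<^sup>+z. ?H t z * ennreal (1 / c ^ (N - 1)) + ?I t z * ennreal ((real N - 1) * c) \<partial>lborel \<partial>lborel)"
      using young_ennreal[OF c N] True
      by (intro nn_integral_mono) (auto simp: G_def indicator_def)
    also have "\<dots> = (\<integral>\<^sup>+t. \<integral>\<^sup>+z. ?H t z \<partial>lborel \<partial>lborel) * ennreal (1 / c ^ (N - 1))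
        + (\<integral>\<^sup>+t. \<integral>\<^sup>+z. ?I t z \<partial>lborel \<partial>lborel) * ennreal ((real N - 1) * c)"
      by (simp add: nn_integral_add nn_integral_multc)
    also have "(\<integral>\<^sup>+t. \<integral>\<^sup>+z. ?H t z \<partial>lborel \<partial>lborel) \<le> ennreal (6 * R / e * \<mu> ^ N / \<tau> ^ (N - 1))"
      using nn_integral_curve_slice[OF assms(1-3) _ assms(5-9), of \<tau>] True \<open>0 < \<mu>\<close>
      by (simp add: N_def nn_integral_multc linepath_def)
    also have "(\<integral>\<^sup>+t. \<integral>\<^sup>+z. ?I t z \<partial>lborel \<partial>lborel) = ennreal (V * R ^ N)"
      using \<open>0 < R\<close> by (simp add: nn_integral_multc nn_integral_cmult_indicator emeasure_annulus N_def V_def)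
    finally have "of_nat N * (\<integral>\<^sup>+t. \<integral>\<^sup>+z. G t z \<tau> \<partial>lborel \<partial>lborel)
        \<le> ennreal (6 * R / e * \<mu> ^ N / \<tau> ^ (N - 1)) * ennreal (1 / c ^ (N - 1)) + ennreal (V * R ^ N) * ennreal ((real N - 1) * c)"
      by (simp add: mult_right_mono add_right_mono)
    also have "\<dots> = ennreal (6 * R / e * \<mu> ^ N / \<tau> ^ (N - 1) * (1 / c ^ (N - 1)) + V * R ^ N * ((real N - 1) * c))"
    proof -
      have "ennreal x * ennreal y + ennreal z * ennreal w = ennreal (x * y + z * w)"
        if "0 \<le> x" "0 \<le> y" "0 \<le> z" "0 \<le> w" for x y z w
        using that by (simp add: ennreal_mult)
      then show ?thesis
        using assms V N c True by auto
    qed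
    also have "6 * R / e * \<mu> ^ N / \<tau> ^ (N - 1) * (1 / c ^ (N - 1)) + V * R ^ N * ((real N - 1) * c)
        = (6 * R / e + (N - 1) * V) * \<mu> * R ^ (N - 1) * \<tau> powr (1 / real N - 1)"
    proof -
      have "\<tau> ^ (N - 1) * c ^ (N - 1) = (\<mu> / R) ^ (N - 1) * (\<tau> * \<tau> powr (1 / real N - 1)) ^ (N - 1)"
        by (simp add: c_def power_mult_distrib power_divide)
      also have "\<tau> * \<tau> powr (1 / real N - 1) = \<tau> powr (1 / real N)"
        using True by (simp add: powr_diff)
      also have "(\<tau> powr (1 / real N)) ^ (N - 1) = \<tau> powr (1 - 1 / real N)"
        using N True by (simp add: powr_realpow[symmetric] powr_powr field_simps of_nat_diff)
      also have "\<tau> powr (1 - 1 / real N) = inverse (\<tau> powr (1 / real N - 1))"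
        by (simp flip: powr_minus)
      finally have *: "\<tau> ^ (N - 1) * c ^ (N - 1) = (\<mu> / R) ^ (N - 1) / \<tau> powr (1 / real N - 1)"
        by (simp add: divide_inverse)
      have "6 * R / e * \<mu> ^ N / \<tau> ^ (N - 1) * (1 / c ^ (N - 1)) = 6 * R / e * \<mu> ^ N / (\<tau> ^ (N - 1) * c ^ (N - 1))"
        by simp
      also have "\<dots> = 6 * R / e * (\<mu> * R ^ (N - 1)) * \<tau> powr (1 / real N - 1)"
        unfolding * using N \<open>0 < \<mu>\<close> \<open>0 < R\<close> by (cases N) (auto simp: power_divide)
      finally show ?thesis
        using N \<open>0 < R\<close> by (cases N) (auto simp: c_def field_simps)
    qed
    also have "ennreal \<dots> = ennreal ((6 * R / e + (N - 1) * V) * \<mu> * R ^ (N - 1)) * ennreal (\<tau> powr (1 / real N - 1))"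
      using assms V by (simp add: ennreal_mult)
    finally show ?thesis
      using True by simp
  qed
  have "(\<integral>\<^sup>+t\<in>{0..1}. (\<integral>\<^sup>+z\<in>?A. ennreal (dist (p t) z) * (\<integral>\<^sup>+\<tau>\<in>{0..1}. \<rho> (linepath (p t) z \<tau>) \<partial>lborel) \<partial>lborel) \<partial>lborel)
      \<le> (\<integral>\<^sup>+t. \<integral>\<^sup>+z. ennreal (3 * R) * (\<integral>\<^sup>+\<tau>. G t z \<tau> \<partial>lborel) \<partial>lborel \<partial>lborel)"
  proof -
    \<comment> \<open>The slice estimate needs \<tau> > 0, so the null set \<tau> = 0 is
      dropped.\<close>
    have 1: "(\<integral>\<^sup>+\<tau>\<in>{0..1}. \<rho> (linepath x z \<tau>) \<partial>lborel) = (\<integral>\<^sup>+\<tau>\<in>{0<..1}. \<rho> (linepath x z \<tau>) \<partial>lborel)" for x z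
      using AE_lborel_singleton[of 0] by (intro nn_integral_cong_AE) (auto elim!: eventually_mono simp: indicator_def)
    have 2: "dist (p t) z \<le> 3 * R" if "t \<in> {0..1}" "z \<in> ?A" for t z
      using a[OF that(1)] that(2) dist_triangle2[of "p t" z a] by (auto simp: annulus_def)
    show ?thesis
      unfolding 1
      by (intro nn_integral_mono)
         (auto simp: G_def indicator_def intro!: nn_integral_mono mult_right_mono ennreal_leI 2)
  qed
  also have "\<dots> = ennreal (3 * R) * (\<integral>\<^sup>+t. \<integral>\<^sup>+z. \<integral>\<^sup>+\<tau>. G t z \<tau> \<partial>lborel \<partial>lborel \<partial>lborel)"
    by (simp add: nn_integral_cmult G_def)
  also have "(\<integral>\<^sup>+t. \<integral>\<^sup>+z. \<integral>\<^sup>+\<tau>. G t z \<tau> \<partial>lborel \<partial>lborel \<partial>lborel) = (\<integral>\<^sup>+t. \<integral>\<^sup>+\<tau>. \<integral>\<^sup>+z. G t z \<tau> \<partial>lborel \<partial>lborel \<partial>lborel)"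
    unfolding G_def by (intro nn_integral_cong lborel_pair.Fubini') measurable
  also have "\<dots> = (\<integral>\<^sup>+\<tau>. \<integral>\<^sup>+t. \<integral>\<^sup>+z. G t z \<tau> \<partial>lborel \<partial>lborel \<partial>lborel)"
    unfolding G_def by (intro lborel_pair.Fubini') measurable
  finally have le: "(\<integral>\<^sup>+t\<in>{0..1}. (\<integral>\<^sup>+z\<in>?A. ennreal (dist (p t) z) * (\<integral>\<^sup>+\<tau>\<in>{0..1}. \<rho> (linepath (p t) z \<tau>) \<partial>lborel) \<partial>lborel) \<partial>lborel)
      \<le> ennreal (3 * R) * (\<integral>\<^sup>+\<tau>. \<integral>\<^sup>+t. \<integral>\<^sup>+z. G t z \<tau> \<partial>lborel \<partial>lborel \<partial>lborel)" (is "?L \<le> _ * ?X") .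
  \<comment> \<open>The weight integrates to N over the unit interval, which cancels the factor N
    from Young's inequality.\<close>
  have "of_nat N * ?X = (\<integral>\<^sup>+\<tau>. of_nat N * (\<integral>\<^sup>+t. \<integral>\<^sup>+z. G t z \<tau> \<partial>lborel \<partial>lborel) \<partial>lborel)"
    unfolding G_def by (rule nn_integral_cmult[symmetric]) measurable
  also have "\<dots> \<le> (\<integral>\<^sup>+\<tau>. ennreal ((6 * R / e + (N - 1) * V) * \<mu> * R ^ (N - 1)) * (ennreal (\<tau> powr (1 / real N - 1)) * indicator {0<..1} \<tau>) \<partial>lborel)"
    by (intro nn_integral_mono slice)
  also have "\<dots> = ennreal ((6 * R / e + (N - 1) * V) * \<mu> * R ^ (N - 1)) * of_nat N"
    using nn_integral_powr_from_0[OF N] by (simp add: nn_integral_cmult ennreal_of_nat_eq_real_of_nat)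
  finally have X: "?X \<le> ennreal ((6 * R / e + (N - 1) * V) * \<mu> * R ^ (N - 1))"
    using N by (subst (asm) mult.commute) (auto simp: ennreal_mult_le_mult_iff mult.commute)
  have "?L \<le> ennreal (3 * R) * ennreal ((6 * R / e + (N - 1) * V) * \<mu> * R ^ (N - 1))"
    using le X by (meson mult_left_mono order_trans zero_le)
  also have "\<dots> = ennreal (3 * (6 * R / e + (N - 1) * V) * \<mu> * R ^ N)"
    using assms V N by (cases N) (auto simp: mult_ac simp flip: ennreal_mult)
  finally show ?thesis
    by (simp add: N_def V_def)
qed

section \<open>Radial segments\<close>

lemma nn_integral_power_inverse:
  assumes "0 < \<alpha>" "0 < N"
  shows "(\<integral>\<^sup>+s\<in>{\<alpha>..2 * \<alpha>}. ennreal (1 / s ^ (N + 1)) \<partial>lborel) = ennreal ((2 ^ N - 1) / (real N * (2 * \<alpha>) ^ N))"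
proof -
  have "(\<integral>\<^sup>+s\<in>{\<alpha>..2 * \<alpha>}. ennreal (1 / s ^ (N + 1)) \<partial>lborel)
      = ennreal (- (inverse (2 * \<alpha>) ^ N / N) - (- (inverse \<alpha> ^ N / N)))"
  proof (rule nn_integral_FTC_Icc)
    fix s assume s: "s \<in> {\<alpha>..2 * \<alpha>}"
    then have "0 < s" using assms by auto
    then have "((\<lambda>s. inverse s ^ N) has_real_derivative real N * (- (inverse s ^ Suc (Suc 0)) * inverse s ^ (N - Suc 0))) (at s)"
      by (intro DERIV_power DERIV_inverse) auto
    moreover have "inverse s ^ Suc (Suc 0) * inverse s ^ (N - Suc 0) = 1 / s ^ (N + 1)"
      using assms by (cases N) (simp_all add: inverse_eq_divide power_one_over)
    ultimately have "((\<lambda>s. inverse s ^ N) has_real_derivative - (real N * (1 / s ^ (N + 1)))) (at s)"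
      by simp
    from DERIV_minus[OF DERIV_cdivide[OF this, of "real N"]]
    show "((\<lambda>s. - (inverse s ^ N / N)) has_real_derivative 1 / s ^ (N + 1)) (at s)"
      by (rule DERIV_cong) (use assms in simp)
    show "0 \<le> 1 / s ^ (N + 1)" using \<open>0 < s\<close> by simp
  qed (use assms in auto)
  also have "- (inverse (2 * \<alpha>) ^ N / N) - (- (inverse \<alpha> ^ N / N)) = (2 ^ N - 1) / (real N * (2 * \<alpha>) ^ N)"
    using assms by (simp add: field_simps power_mult_distrib)
  finally show ?thesis .
qed

lemma nn_integral_inverse_ln:
  assumes "0 < a" "a \<le> b"
  shows "(\<integral>\<^sup>+s\<in>{a..b}. ennreal (1 / s) \<partial>lborel) = ennreal (ln b - ln a)"
  using assms by (intro nn_integral_FTC_Icc) (auto intro!: derivative_eq_intros)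

text \<open>Polar coordinates by Fubini: substitute \<open>w = a + s *\<^sub>R (z - a)\<close> for
  fixed s, then integrate over s for fixed w. The point w is reached for s between \<alpha> and 2
  \<alpha> at most, where \<alpha> = |w - a| / (2 R), and the weight is designed so that this
  s-integral has a bound that does not depend on w.\<close>

lemma nn_integral_radial_slice:
  fixes a :: "'a::euclidean_space" and \<rho> :: "'a \<Rightarrow> ennreal"
  assumes [measurable]: "\<rho> \<in> borel_measurable borel"
    and \<rho>: "(\<integral>\<^sup>+w. \<rho> w ^ DIM('a) \<partial>lborel) \<le> ennreal M" "0 \<le> M"
    and "0 < R"
  shows "(\<integral>\<^sup>+z\<in>annulus a R (2 * R). (\<integral>\<^sup>+s\<in>{1..T}.
            \<rho> (a + s *\<^sub>R (z - a)) ^ DIM('a) * ennreal (norm (z - a) ^ DIM('a) * s ^ (DIM('a) - 1)) \<partial>lborel) \<partial>lborel)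
       \<le> ennreal (M * (R ^ DIM('a) * (2 ^ DIM('a) - 1) / DIM('a)))"
proof -
  define N where "N = DIM('a)"
  have N: "0 < N" by (simp add: N_def)
  let ?A = "annulus a R (2 * R)"
  \<comment> \<open>H is the integrand in the variable w: as
    \<open>norm (z - a) = norm (w - a) / s\<close>, the weight turns into
    \<open>norm (w - a) ^ N / s\<close> and the annulus into a condition relating w and s. The
    Jacobian supplies the further \<open>1 / s ^ N\<close>.\<close>
  define H where "H s w = \<rho> w ^ N * ennreal (norm (w - a) ^ N / s) * indicator {1..T} s
      * (if R * s < norm (w - a) \<and> norm (w - a) < 2 * R * s then 1 else 0 :: ennreal)" for s w
  have [measurable]: "H s \<in> borel_measurable borel" for s
    unfolding H_def[abs_def] by measurable
  have s: "(\<integral>\<^sup>+z. \<rho> (a + s *\<^sub>R (z - a)) ^ N * ennreal (norm (z - a) ^ N * s ^ (N - 1)) * indicator {1..T} s * indicator ?A z \<partial>lborel)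
      = ennreal (1 / s ^ N) * (\<integral>\<^sup>+w. H s w \<partial>lborel)" for s
  proof (cases "s \<in> {1..T}")
    case True
    have "(\<integral>\<^sup>+z. \<rho> (a + s *\<^sub>R (z - a)) ^ N * ennreal (norm (z - a) ^ N * s ^ (N - 1)) * indicator {1..T} s * indicator ?A z \<partial>lborel)
        = (\<integral>\<^sup>+z. H s ((a - s *\<^sub>R a) + s *\<^sub>R z) \<partial>lborel)"
    proof (rule nn_integral_cong)
      fix z
      have *: "(a - s *\<^sub>R a) + s *\<^sub>R z = a + s *\<^sub>R (z - a)"
        by (simp add: algebra_simps)
      have "(s * norm (z - a)) ^ N / s = norm (z - a) ^ N * s ^ (N - 1)"
        using N True by (cases N) (auto simp: power_mult_distrib)
      moreover have "R * s < s * norm (z - a) \<and> s * norm (z - a) < 2 * R * s \<longleftrightarrow> z \<in> ?A"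
        using True by (auto simp: annulus_def dist_norm mult.commute)
      ultimately show "\<rho> (a + s *\<^sub>R (z - a)) ^ N * ennreal (norm (z - a) ^ N * s ^ (N - 1)) * indicator {1..T} s * indicator ?A z
          = H s ((a - s *\<^sub>R a) + s *\<^sub>R z)"
        unfolding * H_def using True by (simp add: indicator_def)
    qed
    also have "\<dots> = ennreal (1 / s ^ N) * (\<integral>\<^sup>+w. H s w \<partial>lborel)"
      unfolding N_def using True by (intro nn_integral_lborel_scale) (auto simp: H_def)
    finally show ?thesis .
  qed (simp add: H_def)
  have w: "(\<integral>\<^sup>+s. ennreal (1 / s ^ N) * H s w \<partial>lborel) \<le> \<rho> w ^ N * ennreal (R ^ N * (2 ^ N - 1) / N)" for w
  proof (cases "w = a")
    case True
    then show ?thesis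
      using N by (simp add: H_def power_0_left)
  next
    case False
    define \<alpha> where "\<alpha> = norm (w - a) / (2 * R)"
    have \<alpha>: "0 < \<alpha>" using False \<open>0 < R\<close> by (simp add: \<alpha>_def)
    have "(\<integral>\<^sup>+s. ennreal (1 / s ^ N) * H s w \<partial>lborel)
        \<le> (\<integral>\<^sup>+s. \<rho> w ^ N * ennreal (norm (w - a) ^ N) * (ennreal (1 / s ^ (N + 1)) * indicator {\<alpha>..2 * \<alpha>} s) \<partial>lborel)"
    proof (rule nn_integral_mono)
      fix s
      show "ennreal (1 / s ^ N) * H s w
          \<le> \<rho> w ^ N * ennreal (norm (w - a) ^ N) * (ennreal (1 / s ^ (N + 1)) * indicator {\<alpha>..2 * \<alpha>} s)"
      proof (cases "s \<in> {1..T} \<and> R * s < norm (w - a) \<and> norm (w - a) < 2 * R * s")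
        case True
        then have "s \<in> {\<alpha>..2 * \<alpha>}"
          using \<open>0 < R\<close> by (auto simp: \<alpha>_def field_simps)
        moreover have "ennreal (1 / s ^ N) * ennreal (norm (w - a) ^ N / s) = ennreal (norm (w - a) ^ N) * ennreal (1 / s ^ (N + 1))"
          using True by (simp add: mult.commute flip: ennreal_mult)
        ultimately show ?thesis
          using True by (simp add: H_def mult_ac)
      qed (auto simp: H_def)
    qed
    also have "\<dots> = \<rho> w ^ N * ennreal (norm (w - a) ^ N) * ennreal ((2 ^ N - 1) / (real N * (2 * \<alpha>) ^ N))"
      using nn_integral_power_inverse[OF \<alpha> N] by (simp add: nn_integral_cmult)
    also have "\<dots> = \<rho> w ^ N * ennreal (norm (w - a) ^ N * ((2 ^ N - 1) / (real N * (2 * \<alpha>) ^ N)))"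
      by (subst ennreal_mult) (use \<alpha> in \<open>auto simp: mult.assoc\<close>)
    also have "norm (w - a) ^ N * ((2 ^ N - 1) / (real N * (2 * \<alpha>) ^ N)) = R ^ N * (2 ^ N - 1) / N"
      using False \<open>0 < R\<close> by (simp add: \<alpha>_def power_divide)
    finally show ?thesis by simp
  qed
  have "(\<integral>\<^sup>+z\<in>?A. (\<integral>\<^sup>+s\<in>{1..T}.
            \<rho> (a + s *\<^sub>R (z - a)) ^ N * ennreal (norm (z - a) ^ N * s ^ (N - 1)) \<partial>lborel) \<partial>lborel)
      = (\<integral>\<^sup>+z. \<integral>\<^sup>+s. \<rho> (a + s *\<^sub>R (z - a)) ^ N * ennreal (norm (z - a) ^ N * s ^ (N - 1)) * indicator {1..T} s * indicator ?A z \<partial>lborel \<partial>lborel)"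
    by (simp add: nn_integral_multc)
  also have "\<dots> = (\<integral>\<^sup>+s. \<integral>\<^sup>+z. \<rho> (a + s *\<^sub>R (z - a)) ^ N * ennreal (norm (z - a) ^ N * s ^ (N - 1)) * indicator {1..T} s * indicator ?A z \<partial>lborel \<partial>lborel)"
    by (intro lborel_pair.Fubini') measurable
  also have "\<dots> = (\<integral>\<^sup>+s. \<integral>\<^sup>+w. ennreal (1 / s ^ N) * H s w \<partial>lborel \<partial>lborel)"
    unfolding s by (intro nn_integral_cong nn_integral_cmult[symmetric]) simp
  also have "\<dots> = (\<integral>\<^sup>+w. \<integral>\<^sup>+s. ennreal (1 / s ^ N) * H s w \<partial>lborel \<partial>lborel)"
    unfolding H_def by (intro lborel_pair.Fubini') measurable
  also have "\<dots> \<le> (\<integral>\<^sup>+w. \<rho> w ^ N * ennreal (R ^ N * (2 ^ N - 1) / N) \<partial>lborel)"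
    by (intro nn_integral_mono w)
  also have "\<dots> = (\<integral>\<^sup>+w. \<rho> w ^ N \<partial>lborel) * ennreal (R ^ N * (2 ^ N - 1) / N)"
    by (rule nn_integral_multc) measurable
  also have "\<dots> \<le> ennreal M * ennreal (R ^ N * (2 ^ N - 1) / N)"
    using \<rho> by (intro mult_right_mono) (auto simp: N_def)
  also have "\<dots> = ennreal (M * (R ^ N * (2 ^ N - 1) / N))"
    using \<rho>(2) \<open>0 < R\<close> by (subst ennreal_mult) auto
  finally show ?thesis by (simp add: N_def)
qed

text \<open>Young's inequality is applied with the parameter \<open>\<kappa> / norm (w - a)\<close>
  at \<open>w = a + s *\<^sub>R (z - a)\<close>, which is the form of the extremal density of a
  spherical ring. So nothing is lost for that density, and the leading constant is exact.\<close>

lemma nn_integral_radial_segments: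
  fixes a :: "'a::euclidean_space" and \<rho> :: "'a \<Rightarrow> ennreal"
  assumes [measurable]: "\<rho> \<in> borel_measurable borel"
    and \<rho>: "(\<integral>\<^sup>+w. \<rho> w ^ DIM('a) \<partial>lborel) \<le> ennreal (\<mu> ^ DIM('a))" "0 < \<mu>"
    and "0 < R" "1 < T"
  shows "(\<integral>\<^sup>+z\<in>annulus a R (2 * R). ennreal (dist z (a + T *\<^sub>R (z - a)))
            * (\<integral>\<^sup>+\<tau>\<in>{0..1}. \<rho> (linepath z (a + T *\<^sub>R (z - a)) \<tau>) \<partial>lborel) \<partial>lborel)
       \<le> ennreal (\<mu> * ln T / (DIM('a) * unit_ball_vol DIM('a) * ln T) powr (1 / DIM('a))
             * (unit_ball_vol DIM('a) * (2 ^ DIM('a) - 1) * R ^ DIM('a)))"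
proof -
  define N where "N = DIM('a)"
  have N: "0 < N" by (simp add: N_def)
  let ?A = "annulus a R (2 * R)"
  define \<omega> where "\<omega> = unit_ball_vol N"
  define L where "L = ln T"
  define q where "q = (N * \<omega> * L) powr (1 / N)"
  \<comment> \<open>This choice makes the energy term equal to \<open>\<kappa> * L\<close> times the
    volume of the annulus and the other term N - 1 times that; their sum carries the factor N that
    is cancelled at the end.\<close>
  define \<kappa> where "\<kappa> = \<mu> / q"
  have \<omega>: "0 < \<omega>" and L: "0 < L"
    using \<open>1 < T\<close> by (auto simp: \<omega>_def L_def)
  then have q: "0 < q" "q ^ N = N * \<omega> * L"
    using N by (auto simp: q_def powr_realpow[symmetric] powr_powr)
  have \<kappa>: "0 < \<kappa>"
    using q \<rho>(2) by (simp add: \<kappa>_def)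
  define G where "G z s = ennreal (norm (z - a)) * \<rho> (a + s *\<^sub>R (z - a)) * indicator {1..T} s * indicator ?A z" for z s
  define H where "H z s = \<rho> (a + s *\<^sub>R (z - a)) ^ N * ennreal (norm (z - a) ^ N * s ^ (N - 1)) * indicator {1..T} s * indicator ?A z" for z s
  have [measurable]: "G z \<in> borel_measurable borel" for z
    unfolding G_def[abs_def] by measurable
  have seg: "ennreal (dist z (a + T *\<^sub>R (z - a))) * (\<integral>\<^sup>+\<tau>\<in>{0..1}. \<rho> (linepath z (a + T *\<^sub>R (z - a)) \<tau>) \<partial>lborel) * indicator ?A z
      = (\<integral>\<^sup>+s. G z s \<partial>lborel)" for z
  proof -
    have "(\<integral>\<^sup>+s. G z s \<partial>lborel) = ennreal (T - 1) * (\<integral>\<^sup>+\<tau>. G z (1 + (T - 1) * \<tau>) \<partial>lborel)"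
      using \<open>1 < T\<close> by (subst nn_integral_real_affine[where c = "T - 1" and t = 1]) auto
    also have "(\<integral>\<^sup>+\<tau>. G z (1 + (T - 1) * \<tau>) \<partial>lborel)
        = (\<integral>\<^sup>+\<tau>. ennreal (norm (z - a)) * indicator ?A z * (\<rho> (linepath z (a + T *\<^sub>R (z - a)) \<tau>) * indicator {0..1} \<tau>) \<partial>lborel)"
    proof (rule nn_integral_cong)
      fix \<tau>
      have "linepath z (a + T *\<^sub>R (z - a)) \<tau> = a + (1 + (T - 1) * \<tau>) *\<^sub>R (z - a)"
        by (simp add: linepath_def algebra_simps)
      moreover have "1 + (T - 1) * \<tau> \<le> T \<longleftrightarrow> 0 \<le> (T - 1) * (1 - \<tau>)"
        by (simp add: algebra_simps)
      then have "1 + (T - 1) * \<tau> \<in> {1..T} \<longleftrightarrow> \<tau> \<in> {0..1}"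
        using \<open>1 < T\<close> by (auto simp: zero_le_mult_iff)
      ultimately show "G z (1 + (T - 1) * \<tau>) = ennreal (norm (z - a)) * indicator ?A z * (\<rho> (linepath z (a + T *\<^sub>R (z - a)) \<tau>) * indicator {0..1} \<tau>)"
        by (simp add: G_def indicator_def)
    qed
    also have "\<dots> = ennreal (norm (z - a)) * indicator ?A z * (\<integral>\<^sup>+\<tau>\<in>{0..1}. \<rho> (linepath z (a + T *\<^sub>R (z - a)) \<tau>) \<partial>lborel)"
      by (rule nn_integral_cmult) measurable
    finally have "(\<integral>\<^sup>+s. G z s \<partial>lborel) = ennreal (T - 1) * ennreal (norm (z - a)) * indicator ?A z * (\<integral>\<^sup>+\<tau>\<in>{0..1}. \<rho> (linepath z (a + T *\<^sub>R (z - a)) \<tau>) \<partial>lborel)"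
      by (simp add: mult_ac)
    moreover have "z - (a + T *\<^sub>R (z - a)) = - ((T - 1) *\<^sub>R (z - a))"
      by (simp add: algebra_simps)
    then have "dist z (a + T *\<^sub>R (z - a)) = (T - 1) * norm (z - a)"
      using \<open>1 < T\<close> by (simp add: dist_norm)
    ultimately show ?thesis
      using \<open>1 < T\<close> by (simp add: ennreal_mult mult_ac)
  qed
  have young: "of_nat N * G z s \<le> H z s * ennreal (1 / \<kappa> ^ (N - 1))
      + ennreal (1 / s) * indicator {1..T} s * indicator ?A z * ennreal ((real N - 1) * \<kappa>)" for z s
  proof (cases "s \<in> {1..T} \<and> z \<in> ?A")
    case True
    define x where "x = norm (z - a)"
    have x: "0 < x" using True \<open>0 < R\<close> by (auto simp: annulus_def dist_norm x_def)
    have s: "1 \<le> s" using True by simp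
    let ?c = "\<kappa> / (s * x)"
    have c: "0 < ?c" using x s \<kappa> by simp
    have "of_nat N * G z s = ennreal x * (of_nat N * \<rho> (a + s *\<^sub>R (z - a)))"
      using True by (simp add: G_def x_def mult_ac)
    also have "\<dots> \<le> ennreal x * (\<rho> (a + s *\<^sub>R (z - a)) ^ N * ennreal (1 / ?c ^ (N - 1)) + ennreal ((real N - 1) * ?c))"
      by (intro mult_left_mono young_ennreal c N) auto
    also have "\<dots> = \<rho> (a + s *\<^sub>R (z - a)) ^ N * (ennreal x * ennreal (1 / ?c ^ (N - 1))) + ennreal x * ennreal ((real N - 1) * ?c)"
      by (simp add: distrib_left mult_ac)
    also have "ennreal x * ennreal (1 / ?c ^ (N - 1)) = ennreal (x ^ N * s ^ (N - 1)) * ennreal (1 / \<kappa> ^ (N - 1))"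
    proof -
      have "x * (1 / ?c ^ (N - 1)) = (x ^ N * s ^ (N - 1)) * (1 / \<kappa> ^ (N - 1))"
        using x s \<kappa> N by (cases N) (auto simp: power_divide power_mult_distrib)
      moreover have "ennreal x * ennreal (1 / ?c ^ (N - 1)) = ennreal (x * (1 / ?c ^ (N - 1)))"
        by (rule ennreal_mult[symmetric]) (use x c in auto)
      moreover have "ennreal (x ^ N * s ^ (N - 1)) * ennreal (1 / \<kappa> ^ (N - 1)) = ennreal ((x ^ N * s ^ (N - 1)) * (1 / \<kappa> ^ (N - 1)))"
        by (rule ennreal_mult[symmetric]) (use x s \<kappa> in auto)
      ultimately show ?thesis
        by (simp only:)
    qed
    also have "ennreal x * ennreal ((real N - 1) * ?c) = ennreal (1 / s) * ennreal ((real N - 1) * \<kappa>)"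
      using x s \<kappa> N by (simp add: field_simps flip: ennreal_mult)
    finally show ?thesis
      using True by (simp add: H_def x_def mult_ac)
  qed (auto simp: G_def)
  have "of_nat N * (\<integral>\<^sup>+z. \<integral>\<^sup>+s. G z s \<partial>lborel \<partial>lborel) = (\<integral>\<^sup>+z. \<integral>\<^sup>+s. of_nat N * G z s \<partial>lborel \<partial>lborel)"
    by (simp add: nn_integral_cmult G_def)
  also have "\<dots> \<le> (\<integral>\<^sup>+z. \<integral>\<^sup>+s. H z s * ennreal (1 / \<kappa> ^ (N - 1))
      + ennreal (1 / s) * indicator {1..T} s * indicator ?A z * ennreal ((real N - 1) * \<kappa>) \<partial>lborel \<partial>lborel)"
    by (intro nn_integral_mono young)
  also have "\<dots> = (\<integral>\<^sup>+z. \<integral>\<^sup>+s. H z s \<partial>lborel \<partial>lborel) * ennreal (1 / \<kappa> ^ (N - 1))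
      + (\<integral>\<^sup>+s\<in>{1..T}. ennreal (1 / s) \<partial>lborel) * emeasure lborel ?A * ennreal ((real N - 1) * \<kappa>)"
    unfolding H_def by (simp add: nn_integral_add nn_integral_multc nn_integral_cmult)
  also have "(\<integral>\<^sup>+s\<in>{1..T}. ennreal (1 / s) \<partial>lborel) = ennreal L"
    using nn_integral_inverse_ln[of 1 T] \<open>1 < T\<close> by (simp add: L_def)
  also have "emeasure lborel ?A = ennreal (\<omega> * (2 ^ N - 1) * R ^ N)"
    using emeasure_annulus[OF \<open>0 < R\<close>, of a] by (simp add: N_def \<omega>_def)
  also have "(\<integral>\<^sup>+z. \<integral>\<^sup>+s. H z s \<partial>lborel \<partial>lborel) \<le> ennreal (\<mu> ^ N * (R ^ N * (2 ^ N - 1) / N))"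
    using nn_integral_radial_slice[OF assms(1,2) _ \<open>0 < R\<close>, of a T] \<rho>(2)
    by (simp add: H_def N_def nn_integral_multc)
  finally have "of_nat N * (\<integral>\<^sup>+z. \<integral>\<^sup>+s. G z s \<partial>lborel \<partial>lborel)
      \<le> ennreal (\<mu> ^ N * (R ^ N * (2 ^ N - 1) / N)) * ennreal (1 / \<kappa> ^ (N - 1))
        + ennreal L * ennreal (\<omega> * (2 ^ N - 1) * R ^ N) * ennreal ((real N - 1) * \<kappa>)"
    by (simp add: mult_right_mono add_right_mono)
  also have "\<dots> = ennreal (\<mu> ^ N * (R ^ N * (2 ^ N - 1) / N) * (1 / \<kappa> ^ (N - 1))
        + L * (\<omega> * (2 ^ N - 1) * R ^ N) * ((real N - 1) * \<kappa>))"
  proof -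
    have "ennreal x * ennreal y + ennreal z * ennreal w * ennreal v = ennreal (x * y + z * w * v)"
      if "0 \<le> x" "0 \<le> y" "0 \<le> z" "0 \<le> w" "0 \<le> v" for x y z w v
      using that by (simp add: ennreal_mult)
    then show ?thesis
      using assms N \<omega> L \<kappa> by auto
  qed
  also have "\<mu> ^ N * (R ^ N * (2 ^ N - 1) / N) * (1 / \<kappa> ^ (N - 1)) + L * (\<omega> * (2 ^ N - 1) * R ^ N) * ((real N - 1) * \<kappa>)
      = N * (\<kappa> * L * (\<omega> * (2 ^ N - 1) * R ^ N))"
  proof -
    have "\<mu> ^ N = \<kappa> * \<kappa> ^ (N - 1) * (N * \<omega> * L)"
      using q N \<omega> L by (simp add: \<kappa>_def power_divide flip: power_Suc)
    then have "\<mu> ^ N * (R ^ N * (2 ^ N - 1) / N) * (1 / \<kappa> ^ (N - 1)) = \<kappa> * L * (\<omega> * (2 ^ N - 1) * R ^ N)"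
      using N \<kappa> by simp
    then show ?thesis by (simp add: algebra_simps)
  qed
  finally have "of_nat N * (\<integral>\<^sup>+z. \<integral>\<^sup>+s. G z s \<partial>lborel \<partial>lborel) \<le> of_nat N * ennreal (\<kappa> * L * (\<omega> * (2 ^ N - 1) * R ^ N))"
    using \<kappa> L \<omega> \<open>0 < R\<close> by (simp add: ennreal_mult ennreal_of_nat_eq_real_of_nat)
  then have "(\<integral>\<^sup>+z. \<integral>\<^sup>+s. G z s \<partial>lborel \<partial>lborel) \<le> ennreal (\<kappa> * L * (\<omega> * (2 ^ N - 1) * R ^ N))"
    using N by (simp add: ennreal_mult_le_mult_iff)
  then show ?thesis
    unfolding seg by (simp add: \<kappa>_def L_def q_def N_def \<omega>_def)
qed

section \<open>Averaging over test paths\<close>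

text \<open>The test paths are \<open>p t \<rightarrow> z \<rightarrow> a + T (z - a) \<rightarrow> q t\<close>, averaged over \<open>t\<close> and \<open>z\<close>; only the radial
  middle segment sees the many scales between the two curves.\<close>

lemma test_path_average:
  fixes p q :: "real \<Rightarrow> 'a::euclidean_space" and \<rho> :: "'a \<Rightarrow> ennreal" and V :: real
  assumes [measurable]: "\<rho> \<in> borel_measurable borel" "p \<in> borel_measurable borel" "q \<in> borel_measurable borel"
    and \<rho>: "(\<integral>\<^sup>+w. \<rho> w ^ DIM('a) \<partial>lborel) \<le> ennreal (\<mu> ^ DIM('a))" "0 < \<mu>"
    and pos: "0 < R" "1 < T" "0 < e"
    and u: "norm u = 1" "\<And>t. t \<in> {0..1} \<Longrightarrow> p t \<bullet> u = b + t * R"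
    and v: "norm v = 1" "\<And>t. t \<in> {0..1} \<Longrightarrow> q t \<bullet> v = c + t * e"
    and p: "\<And>t. t \<in> {0..1} \<Longrightarrow> p t \<in> E \<and> dist (p t) a \<le> R"
    and q: "\<And>t. t \<in> {0..1} \<Longrightarrow> q t \<in> F \<and> dist (q t) a \<le> T * R"
    and adm: "\<And>\<gamma>. \<gamma> \<in> paths_between E F UNIV \<Longrightarrow> rectifiable_path \<gamma> \<Longrightarrow> 1 \<le> line_integral \<rho> \<gamma>"
  defines "V \<equiv> unit_ball_vol DIM('a) * (2 ^ DIM('a) - 1)"
  shows "1 \<le> \<mu> * (3 * (6 + (real DIM('a) - 1) * V) / V + 3 * (6 * (T * R) / e + (real DIM('a) - 1) * V) / V
                 + ln T / (DIM('a) * unit_ball_vol DIM('a) * ln T) powr (1 / DIM('a)))"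
proof -
  define N where "N = DIM('a)"
  have N: "0 < N" by (simp add: N_def)
  let ?A = "annulus a R (2 * R)"
  let ?B = "annulus a (T * R) (2 * (T * R))"
  define I where "I x y = ennreal (dist x y) * (\<integral>\<^sup>+\<tau>\<in>{0..1}. \<rho> (linepath x y \<tau>) \<partial>lborel)" for x y
  have I [measurable]: "(\<lambda>x. I (f x) (g x)) \<in> borel_measurable M"
    if "f \<in> borel_measurable M" "g \<in> borel_measurable M" for f g and M :: "(real \<times> 'a) measure"
    using that unfolding I_def by measurable
  have I' [measurable]: "(\<lambda>x. I (f x) (g x)) \<in> borel_measurable M"
    if "f \<in> borel_measurable M" "g \<in> borel_measurable M" for f g and M :: "'a measure"
    using that unfolding I_def by measurable
  define \<phi> where "\<phi> z = a + T *\<^sub>R (z - a)" for z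
  have [measurable]: "\<phi> \<in> borel_measurable borel"
    unfolding \<phi>_def[abs_def] by measurable
  have V: "0 < V"
    by (simp add: V_def)
  \<comment> \<open>k1 and k2 belong to the segments at p t and q t, k3 to the radial one. The
    direction component of p moves at speed R itself, so the ratio 6 * R / e of the general bound is
    6 in k1.\<close>
  define k1 k2 k3 where "k1 = 3 * (6 + (real N - 1) * V)" and "k2 = 3 * (6 * (T * R) / e + (real N - 1) * V)"
    and "k3 = ln T / (N * unit_ball_vol N * ln T) powr (1 / N)"
  have k: "0 \<le> k1" "0 \<le> k2" "0 \<le> k3"
    using V pos N by (auto simp: k1_def k2_def k3_def)
  let ?J = "\<lambda>f. \<integral>\<^sup>+t\<in>{0..1::real}. (\<integral>\<^sup>+z\<in>?A. f t z \<partial>lborel) \<partial>lborel"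
  have one: "1 \<le> I (p t) z + I z (\<phi> z) + I (q t) (\<phi> z)" if "t \<in> {0..1}" for t z
  proof -
    have *: "line_integral \<rho> (linepath x y) = I x y" for x y
      by (simp add: I_def line_integral_linepath)
    \<comment> \<open>The last segment is reversed so that it also issues from its curve, as the
      estimate for end segments requires.\<close>
    have sym: "I (\<phi> z) (q t) = I (q t) (\<phi> z)"
    proof -
      have "(\<integral>\<^sup>+\<tau>\<in>{0..1}. \<rho> (linepath (\<phi> z) (q t) \<tau>) \<partial>lborel)
          = (\<integral>\<^sup>+\<tau>. \<rho> (linepath (\<phi> z) (q t) (1 - \<tau>)) * indicator {0..1} (1 - \<tau>) \<partial>lborel)"
        by (subst nn_integral_real_affine[where c = "-1" and t = 1]) auto
      also have "\<dots> = (\<integral>\<^sup>+\<tau>\<in>{0..1}. \<rho> (linepath (q t) (\<phi> z) \<tau>) \<partial>lborel)"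
        by (intro nn_integral_cong) (auto simp: linepath_def indicator_def add.commute)
      finally show ?thesis by (simp add: I_def dist_commute)
    qed
    let ?g = "linepath z (\<phi> z) +++ linepath (\<phi> z) (q t)"
    let ?h = "linepath (p t) z +++ ?g"
    have g: "rectifiable_path ?g" "line_integral \<rho> ?g \<le> I z (\<phi> z) + I (\<phi> z) (q t)"
      using line_integral_joinpaths_le[of "linepath z (\<phi> z)" "linepath (\<phi> z) (q t)" \<rho>] by (simp_all add: *)
    have h: "rectifiable_path ?h" "line_integral \<rho> ?h \<le> I (p t) z + line_integral \<rho> ?g"
      using line_integral_joinpaths_le[of "linepath (p t) z" ?g \<rho>] g(1) by (simp_all add: *)
    have "?h \<in> paths_between E F UNIV"
      using p[OF that] q[OF that] by (simp add: paths_between_def)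
    from adm[OF this h(1)] have "1 \<le> I (p t) z + line_integral \<rho> ?g"
      using h(2) by order
    also have "\<dots> \<le> I (p t) z + (I z (\<phi> z) + I (q t) (\<phi> z))"
      using g(2) sym by (intro add_left_mono) simp
    finally show ?thesis by (simp add: add.assoc)
  qed
  have "ennreal (V * R ^ N) = ?J (\<lambda>t z. 1)"
    using emeasure_annulus[OF pos(1), of a]
    by (simp add: V_def N_def nn_integral_cmult_indicator)
  also have "\<dots> \<le> ?J (\<lambda>t z. I (p t) z + I z (\<phi> z) + I (q t) (\<phi> z))"
    using one by (intro nn_integral_mono) (auto simp: indicator_def intro!: nn_integral_mono)
  also have "\<dots> = ?J (\<lambda>t z. I (p t) z) + ?J (\<lambda>t z. I z (\<phi> z)) + ?J (\<lambda>t z. I (q t) (\<phi> z))"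
    by (simp add: distrib_right nn_integral_add)
  also have "?J (\<lambda>t z. I (p t) z) \<le> ennreal (k1 * \<mu> * R ^ N)"
    using nn_integral_segments_to_curve[OF assms(1,2) \<rho> pos(1) pos(1) u, of a] p pos(1)
    by (simp add: I_def k1_def V_def N_def)
  also have "?J (\<lambda>t z. I z (\<phi> z)) \<le> ennreal (\<mu> * k3 * V * R ^ N)"
  proof -
    have "?J (\<lambda>t z. I z (\<phi> z)) = (\<integral>\<^sup>+z\<in>?A. I z (\<phi> z) \<partial>lborel)"
      by (subst nn_integral_cmult_indicator) auto
    then show ?thesis
      using nn_integral_radial_segments[OF assms(1) \<rho> pos(1,2), of a]
      by (simp add: I_def k3_def V_def N_def \<phi>_def mult_ac)
  qed
  also have "?J (\<lambda>t z. I (q t) (\<phi> z)) \<le> ennreal (k2 * \<mu> * R ^ N)"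
  proof -
    \<comment> \<open>\<phi> carries the annulus of scale R onto that of scale T R. Its Jacobian
      cancels the larger volume there, so the far end part is bounded on the scale of q, however
      large T is.\<close>
    have "(\<integral>\<^sup>+z\<in>?A. I (q t) (\<phi> z) \<partial>lborel) = ennreal (1 / T ^ N) * (\<integral>\<^sup>+z\<in>?B. I (q t) z \<partial>lborel)" for t
    proof -
      have "z \<in> ?A \<longleftrightarrow> \<phi> z \<in> ?B" for z
      proof -
        have "dist (\<phi> z) a = T * dist z a"
          using pos by (simp add: \<phi>_def dist_norm)
        moreover have "2 * (T * R) = T * (2 * R)" by simp
        ultimately show ?thesis
          using pos by (simp only: annulus_def mem_Collect_eq) (simp add: mult_less_cancel_left_pos)
      qed
      moreover have "\<phi> z = (a - T *\<^sub>R a) + T *\<^sub>R z" for z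
        by (simp add: \<phi>_def algebra_simps)
      ultimately have "(\<integral>\<^sup>+z\<in>?A. I (q t) (\<phi> z) \<partial>lborel)
          = (\<integral>\<^sup>+z. (\<lambda>w. I (q t) w * indicator ?B w) ((a - T *\<^sub>R a) + T *\<^sub>R z) \<partial>lborel)"
        by (simp add: indicator_def)
      also have "\<dots> = ennreal (1 / T ^ N) * (\<integral>\<^sup>+z\<in>?B. I (q t) z \<partial>lborel)"
        unfolding N_def using pos by (intro nn_integral_lborel_scale) auto
      finally show ?thesis .
    qed
    then have "?J (\<lambda>t z. I (q t) (\<phi> z)) = ennreal (1 / T ^ N) * (\<integral>\<^sup>+t\<in>{0..1::real}. (\<integral>\<^sup>+z\<in>?B. I (q t) z \<partial>lborel) \<partial>lborel)"
      by (simp add: mult.assoc nn_integral_cmult)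
    also have "\<dots> \<le> ennreal (1 / T ^ N) * ennreal (k2 * \<mu> * (T * R) ^ N)"
      using nn_integral_segments_to_curve[OF assms(1,3) \<rho> _ pos(3) v, of "T * R" a] q pos
      by (intro mult_left_mono) (simp_all add: I_def k2_def V_def N_def)
    also have "\<dots> = ennreal (k2 * \<mu> * R ^ N)"
      using pos k \<rho>(2) by (simp add: power_mult_distrib flip: ennreal_mult)
    finally show ?thesis .
  qed
  finally have "ennreal (V * R ^ N) \<le> ennreal (k1 * \<mu> * R ^ N) + ennreal (\<mu> * k3 * V * R ^ N) + ennreal (k2 * \<mu> * R ^ N)"
    by (simp add: add_mono)
  also have "\<dots> = ennreal (k1 * \<mu> * R ^ N + \<mu> * k3 * V * R ^ N + k2 * \<mu> * R ^ N)"
    using k V \<rho>(2) pos by (simp add: ennreal_plus)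
  finally have "V * R ^ N \<le> k1 * \<mu> * R ^ N + \<mu> * k3 * V * R ^ N + k2 * \<mu> * R ^ N"
    using k V \<rho>(2) pos by (subst (asm) ennreal_le_iff) auto
  also have "\<dots> = (\<mu> * (k1 / V + k2 / V + k3)) * (V * R ^ N)"
    using V by (simp add: field_simps)
  finally have "1 \<le> \<mu> * (k1 / V + k2 / V + k3)"
    using V pos by (simp add: mult_le_cancel_right1)
  then show ?thesis
    by (simp add: k1_def k2_def k3_def N_def)
qed

text \<open>The curve is parametrised by the first time at which its component in the direction of a
  farthest point reaches a given value; this time is monotone, so the parametrisation is Borel.\<close>

lemma path_first_hitting_param:
  fixes \<gamma> :: "real \<Rightarrow> 'a::euclidean_space"
  assumes "path \<gamma>" "b \<in> path_image \<gamma>" "b \<noteq> pathstart \<gamma>"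
  obtains p u where "p \<in> borel_measurable borel" "norm u = 1"
    "\<And>t. t \<in> {0..1} \<Longrightarrow> p t \<in> path_image \<gamma>"
    "\<And>t. t \<in> {0..1} \<Longrightarrow> p t \<bullet> u = pathstart \<gamma> \<bullet> u + t * dist (pathstart \<gamma>) b"
proof -
  define a where "a = pathstart \<gamma>"
  define d where "d = dist a b"
  have d: "0 < d" using assms(3) by (simp add: a_def d_def)
  define u where "u = (b - a) /\<^sub>R d"
  have u: "norm u = 1" "b \<bullet> u - a \<bullet> u = d"
  proof -
    show "norm u = 1" using d by (simp add: u_def d_def dist_norm norm_minus_commute)
    have "b \<bullet> u - a \<bullet> u = (b - a) \<bullet> (b - a) / d"
      unfolding u_def by (simp add: inner_diff_left divide_inverse mult.commute right_diff_distrib)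
    also have "\<dots> = d"
      using d by (simp add: d_def dist_norm norm_minus_commute dot_square_norm power2_eq_square)
    finally show "b \<bullet> u - a \<bullet> u = d" .
  qed
  obtain s1 where s1: "s1 \<in> {0..1}" "\<gamma> s1 = b"
    using assms(2) by (auto simp: path_image_def)
  define g where "g s = \<gamma> s \<bullet> u - a \<bullet> u" for s
  have cont: "continuous_on {0..1} \<gamma>"
    using assms(1) by (simp add: path_def)
  then have g: "continuous_on {0..1} g"
    unfolding g_def[abs_def] by (intro continuous_intros)
  \<comment> \<open>Clamping keeps the hitting sets nonempty for every real t, so that the hitting
    time is defined and monotone, hence Borel, on the whole line.\<close>
  define cl where "cl t = min 1 (max 0 t)" for t :: real
  define S where "S t = {s \<in> {0..1}. cl t * d \<le> g s}" for t
  define \<tau> where "\<tau> t = Inf (S t)" for t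
  have s1S: "s1 \<in> S t" for t
    using s1 u(2) d by (auto simp: S_def g_def cl_def)
  have bdd: "bdd_below (S t)" for t
    by (rule bdd_belowI[of _ 0]) (auto simp: S_def)
  have "S t = g -` {cl t * d..} \<inter> {0..1}" for t
    by (auto simp: S_def)
  then have "closed (S t)" for t
    using continuous_on_closed_vimage[of "{0..1}" g] g by auto
  then have \<tau>S: "\<tau> t \<in> S t" for t
    unfolding \<tau>_def using s1S bdd by (intro closed_contains_Inf) auto
  have "mono \<tau>"
  proof
    fix s t :: real assume "s \<le> t"
    then have "cl s \<le> cl t" by (auto simp: cl_def)
    then have "cl s * d \<le> cl t * d"
      using d by simp
    then have "S t \<subseteq> S s"
      unfolding S_def by (blast intro: order_trans)
    then show "\<tau> s \<le> \<tau> t"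
      unfolding \<tau>_def using s1S bdd by (intro cInf_superset_mono) auto
  qed
  then have [measurable]: "\<tau> \<in> borel_measurable borel"
    by (rule borel_measurable_mono)
  have "continuous_on UNIV (\<lambda>s. \<gamma> (cl s))"
    unfolding cl_def by (rule continuous_on_compose2[OF cont]) (auto intro!: continuous_intros)
  then have [measurable]: "(\<lambda>s. \<gamma> (cl s)) \<in> borel_measurable borel"
    by (rule borel_measurable_continuous_onI)
  have \<tau>: "\<tau> t \<in> {0..1}" for t
    using \<tau>S[of t] by (auto simp: S_def)
  show ?thesis
  proof (rule that[of "\<lambda>t. \<gamma> (\<tau> t)" u])
    have "(\<lambda>t. \<gamma> (cl (\<tau> t))) \<in> borel_measurable borel"
      by measurable
    also have "(\<lambda>t. \<gamma> (cl (\<tau> t))) = (\<lambda>t. \<gamma> (\<tau> t))"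
      using \<tau> by (simp add: cl_def)
    finally show "(\<lambda>t. \<gamma> (\<tau> t)) \<in> borel_measurable borel" .
    show "\<gamma> (\<tau> t) \<in> path_image \<gamma>" for t
      using \<tau> by (auto simp: path_image_def)
    fix t :: real assume t: "t \<in> {0..1}"
    then have cl: "cl t = t" by (simp add: cl_def)
    have "g 0 = 0"
      by (simp add: g_def a_def pathstart_def)
    have "g (\<tau> t) = t * d"
    proof (rule antisym)
      show "t * d \<le> g (\<tau> t)"
        using \<tau>S[of t] cl by (simp add: S_def)
      \<comment> \<open>The value t * d is attained at some s not after the hitting time; minimality
        forces s to be that time, so the component does not overshoot.\<close>
      then obtain s where s: "0 \<le> s" "s \<le> \<tau> t" "g s = t * d"
        using IVT'[of g 0 "t * d" "\<tau> t"] \<open>g 0 = 0\<close> t d \<tau>[of t] continuous_on_subset[OF g, of "{0..\<tau> t}"]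
        by auto
      then have "s \<in> S t"
        using \<tau>[of t] cl by (auto simp: S_def)
      then have "\<tau> t \<le> s"
        unfolding \<tau>_def by (intro cInf_lower bdd)
      then show "g (\<tau> t) \<le> t * d"
        using s by simp
    qed
    then show "\<gamma> (\<tau> t) \<bullet> u = pathstart \<gamma> \<bullet> u + t * dist (pathstart \<gamma>) b"
      by (simp add: g_def a_def d_def)
  qed (rule u(1))
qed

section \<open>Bounds for the modulus\<close>

text \<open>The two end terms of \<open>test_path_average\<close>, with
  \<open>6 * (T * R) / e\<close> replaced by its bound \<open>36 * R0 / \<delta>\<close>, which
  comes from the outer radius 6 * R0 and e \<ge> \<delta>.\<close>

definition curve_const :: "nat \<Rightarrow> real \<Rightarrow> real \<Rightarrow> real" where
  "curve_const n \<delta> R0 = (let V = unit_ball_vol n * (2 ^ n - 1) in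
     3 * (6 + (real n - 1) * V) / V + 3 * (36 * R0 / \<delta> + (real n - 1) * V) / V)"

lemma curve_const_nonneg:
  assumes "0 < n" "0 < \<delta>" "0 < R0"
  shows "0 \<le> curve_const n \<delta> R0"
proof -
  have "0 \<le> unit_ball_vol n * (2 ^ n - 1)" by simp
  then show ?thesis
    using assms unfolding curve_const_def Let_def by (intro add_nonneg_nonneg divide_nonneg_nonneg mult_nonneg_nonneg) auto
qed

lemma path_farthest_point:
  fixes \<gamma> :: "real \<Rightarrow> 'a::euclidean_space"
  assumes "path \<gamma>"
  obtains b where "b \<in> path_image \<gamma>" "\<And>x. x \<in> path_image \<gamma> \<Longrightarrow> dist x (pathstart \<gamma>) \<le> dist (pathstart \<gamma>) b"
proof -
  have "\<exists>b\<in>path_image \<gamma>. \<forall>x\<in>path_image \<gamma>. dist (pathstart \<gamma>) x \<le> dist (pathstart \<gamma>) b"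
    using assms by (intro continuous_attains_sup compact_path_image) (auto intro!: continuous_intros)
  then show ?thesis
    using that by (auto simp: dist_commute)
qed

text \<open>A modulus strictly below \<open>\<mu> ^ n\<close> supplies an admissible density of
  energy below \<open>\<mu> ^ n\<close>, to which the averaging over test paths applies. The inner
  scale is the distance d from the start of \<gamma> to its farthest point, which keeps the first
  curve within distance d of a; d is replaced by the distance of the end points only at the
  end.\<close>

lemma modulus_connecting_curves_lower:
  fixes \<gamma> \<sigma> :: "real \<Rightarrow> real^'n"
  defines "n \<equiv> CARD('n)"
  assumes "path \<gamma>" "path \<sigma>" and ball: "path_image \<gamma> \<subseteq> ball 0 R0" "path_image \<sigma> \<subseteq> ball 0 R0"
    and ne: "pathstart \<gamma> \<noteq> pathfinish \<gamma>"
    and \<delta>: "0 < \<delta>" "\<delta> \<le> dist (pathstart \<sigma>) (pathfinish \<sigma>)"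
    and mod: "modulus (paths_between (path_image \<gamma>) (path_image \<sigma>) UNIV) < ennreal (\<mu> ^ n)" "0 < \<mu>"
  shows "1 \<le> \<mu> * (curve_const n \<delta> R0 + ln (6 * R0 / dist (pathstart \<gamma>) (pathfinish \<gamma>)) powr (1 - 1 / n)
            / (n * unit_ball_vol n) powr (1 / n))"
proof -
  let ?E = "path_image \<gamma>" and ?F = "path_image \<sigma>"
  have n: "0 < n" by (simp add: n_def)
  define a where "a = pathstart \<gamma>"
  define D where "D = dist a (pathfinish \<gamma>)"
  have D: "0 < D" using ne by (simp add: D_def a_def)
  obtain b where b: "b \<in> ?E" "\<And>x. x \<in> ?E \<Longrightarrow> dist x a \<le> dist a b"
    using path_farthest_point[OF assms(2)] unfolding a_def by blast
  obtain c where c: "c \<in> ?F" "\<And>x. x \<in> ?F \<Longrightarrow> dist x (pathstart \<sigma>) \<le> dist (pathstart \<sigma>) c"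
    using path_farthest_point[OF assms(3)] by blast
  define d e where "d = dist a b" and "e = dist (pathstart \<sigma>) c"
  have "D \<le> d"
    using b(2)[OF pathfinish_in_path_image] by (simp add: D_def d_def dist_commute)
  have "\<delta> \<le> e"
    using c(2)[OF pathfinish_in_path_image] \<delta> by (simp add: e_def dist_commute)
  have diam: "dist x a < 2 * R0" if "x \<in> ball 0 R0" for x
    using that ball(1) pathstart_in_path_image[of \<gamma>] dist_triangle2[of x a 0]
    by (auto simp: a_def dist_commute)
  have d: "0 < d" "d < 2 * R0"
    using D \<open>D \<le> d\<close> diam[of b] b(1) ball(1) by (auto simp: d_def dist_commute)
  \<comment> \<open>The outer radius T * d = 6 * R0 does not depend on the curves; it exceeds d and
    the distance, below 2 * R0, from a to any point of the second curve.\<close>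
  define T where "T = 6 * R0 / d"
  have T: "1 < T" "T * d = 6 * R0"
    using d by (auto simp: T_def field_simps)
  obtain p u where p: "p \<in> borel_measurable borel" "norm u = 1"
    "\<And>t. t \<in> {0..1} \<Longrightarrow> p t \<in> ?E" "\<And>t. t \<in> {0..1} \<Longrightarrow> p t \<bullet> u = a \<bullet> u + t * d"
    using path_first_hitting_param[OF assms(2) b(1)] d(1) unfolding a_def d_def by auto
  obtain q v where q: "q \<in> borel_measurable borel" "norm v = 1"
    "\<And>t. t \<in> {0..1} \<Longrightarrow> q t \<in> ?F" "\<And>t. t \<in> {0..1} \<Longrightarrow> q t \<bullet> v = pathstart \<sigma> \<bullet> v + t * e"
  proof -
    have "c \<noteq> pathstart \<sigma>" using \<delta>(1) \<open>\<delta> \<le> e\<close> by (auto simp: e_def)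
    then show ?thesis
      using path_first_hitting_param[OF assms(3) c(1)] that unfolding e_def by blast
  qed
  obtain \<rho> where \<rho>: "\<rho> \<in> admissible (paths_between ?E ?F UNIV)" "(\<integral>\<^sup>+x. \<rho> x ^ n \<partial>lebesgue) < ennreal (\<mu> ^ n)"
    using mod(1) by (auto simp: modulus_def INF_less_iff n_def)
  have adm: "\<rho> \<in> borel_measurable borel"
    "\<And>\<gamma>. \<gamma> \<in> paths_between ?E ?F UNIV \<Longrightarrow> rectifiable_path \<gamma> \<Longrightarrow> 1 \<le> line_integral \<rho> \<gamma>"
    using \<rho>(1) by (auto simp: admissible_def)
  have "(\<integral>\<^sup>+x. \<rho> x ^ n \<partial>lborel) \<le> ennreal (\<mu> ^ n)"
    using \<rho>(2) by (simp add: nn_integral_completion)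
  then have int: "(\<integral>\<^sup>+x. \<rho> x ^ DIM(real^'n) \<partial>lborel) \<le> ennreal (\<mu> ^ DIM(real^'n))"
    by (simp add: n_def)
  have pE: "p t \<in> ?E \<and> dist (p t) a \<le> d" if "t \<in> {0..1}" for t
    using p(3)[OF that] b(2) by (simp add: d_def)
  have qF: "q t \<in> ?F \<and> dist (q t) a \<le> T * d" if "t \<in> {0..1}" for t
    using q(3)[OF that] diam[of "q t"] ball(2) T(2) d by auto
  define V where "V = unit_ball_vol n * (2 ^ n - 1)"
  have V: "0 < V" using n by (simp add: V_def)
  have "1 \<le> \<mu> * (3 * (6 + (real n - 1) * V) / V + 3 * (6 * (T * d) / e + (real n - 1) * V) / V
                 + ln T / (n * unit_ball_vol n * ln T) powr (1 / n))"
    using test_path_average[OF adm(1) p(1) q(1) int mod(2) d(1) T(1) _ p(2,4) q(2,4) pE qF adm(2)] \<open>\<delta> \<le> e\<close> \<delta>(1)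
    by (simp add: n_def V_def)
  also have "\<dots> \<le> \<mu> * (curve_const n \<delta> R0 + ln (6 * R0 / D) powr (1 - 1 / n) / (n * unit_ball_vol n) powr (1 / n))"
  proof -
    have "6 * (T * d) / e \<le> 36 * R0 / \<delta>"
      using \<open>\<delta> \<le> e\<close> \<delta>(1) d unfolding T(2) by (simp add: frac_le)
    then have "3 * (6 + (real n - 1) * V) / V + 3 * (6 * (T * d) / e + (real n - 1) * V) / V \<le> curve_const n \<delta> R0"
      using V unfolding curve_const_def Let_def V_def[symmetric]
      by (intro add_left_mono divide_right_mono mult_left_mono add_right_mono) auto
    moreover have "ln T / (n * unit_ball_vol n * ln T) powr (1 / n) \<le> ln (6 * R0 / D) powr (1 - 1 / n) / (n * unit_ball_vol n) powr (1 / n)"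
    proof -
      have "0 < ln T" using T(1) by simp
      have "ln T / (n * unit_ball_vol n * ln T) powr (1 / n) = ln T powr (1 - 1 / n) / (n * unit_ball_vol n) powr (1 / n)"
        using \<open>0 < ln T\<close> n by (simp add: powr_mult powr_diff)
      also have "ln T \<le> ln (6 * R0 / D)"
        using D d \<open>D \<le> d\<close> by (simp add: T_def frac_le)
      then have "ln T powr (1 - 1 / n) / (n * unit_ball_vol n) powr (1 / n) \<le> ln (6 * R0 / D) powr (1 - 1 / n) / (n * unit_ball_vol n) powr (1 / n)"
        using \<open>0 < ln T\<close> n by (intro divide_right_mono powr_mono2) auto
      finally show ?thesis .
    qed
    ultimately show ?thesis
      using mod(2) by (intro mult_left_mono add_mono) auto
  qed
  finally show ?thesis
    by (simp add: D_def a_def)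
qed

section \<open>Upper bound for the modulus from the ring condition\<close>

lemma dyadic_shell:
  fixes s r2 :: real
  assumes "0 < r1" "r1 < s" "s < r2"
  obtains k where "real k \<le> log 2 (r2 / r1)" "s < r2 / 2 ^ k" "r2 / 2 ^ (k + 1) \<le> s"
proof -
  define k where "k = nat \<lfloor>log 2 (r2 / s)\<rfloor>"
  have s: "0 < s" using assms by simp
  have l: "0 < log 2 (r2 / s)" using assms by simp
  then have k: "real k \<le> log 2 (r2 / s)" "log 2 (r2 / s) < real k + 1"
    by (auto simp: k_def)
  \<comment> \<open>If s equals r2 / 2 ^ k, the strict inequality needed for the open ball fails and
    the next larger shell is taken; k is then positive because the logarithm is.\<close>
  define k' where "k' = (if real k = log 2 (r2 / s) then k - 1 else k)"
  have k': "real k' < log 2 (r2 / s)" "log 2 (r2 / s) \<le> real k' + 1"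
    using k l by (auto simp: k'_def)
  have "2 powr real k' < r2 / s" "r2 / s \<le> 2 powr (real k' + 1)"
    using k' assms s by (auto simp: less_log_iff log_le_iff)
  then have "s < r2 / 2 ^ k'" "r2 / 2 ^ (k' + 1) \<le> s"
    using s by (auto simp: powr_realpow powr_add field_simps)
  moreover have "log 2 (r2 / s) \<le> log 2 (r2 / r1)"
    using assms by (simp add: frac_le)
  then have "real k' \<le> log 2 (r2 / r1)"
    using k'(1) by linarith
  ultimately show ?thesis using that by blast
qed

text \<open>On each dyadic shell the weight exceeds its value on the outer sphere by at most 2 ^ n,
  and the growth of Q over balls matches that value. So every shell contributes at most
  \<open>2 ^ n * c / \<Lambda> ^ n\<close>, and only their number matters.\<close>

lemma weighted_annulus_integral:
  fixes x0 :: "real^'n" and Q :: "real^'n \<Rightarrow> ennreal"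
  defines "n \<equiv> CARD('n)"
  assumes Q: "Q \<in> borel_measurable lebesgue" and D: "D \<in> sets lebesgue" "\<And>x. x \<notin> D \<Longrightarrow> Q x = 0"
    and ball: "\<And>r. 0 < r \<Longrightarrow> r \<le> r2 \<Longrightarrow> (\<integral>\<^sup>+x\<in>ball x0 r \<inter> D. Q x \<partial>lebesgue) \<le> ennreal (c * r ^ n)"
    and "0 \<le> c" and r: "0 < r1" "32 * r1 \<le> r2"
  shows "(\<integral>\<^sup>+x\<in>annulus x0 r1 r2. Q x * ennreal (1 / (norm (x - x0) * ln (r2 / r1))) ^ n \<partial>lebesgue)
      \<le> ennreal (6 / 5 * 2 ^ n * c / (ln 2 * ln (r2 / r1) ^ (n - 1)))"
proof -
  have n: "0 < n" by (simp add: n_def)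
  define \<Lambda> where "\<Lambda> = ln (r2 / r1)"
  define N where "N = nat \<lfloor>log 2 (r2 / r1)\<rfloor> + 1"
  \<comment> \<open>Since 32 = 2 ^ 5, at least five dyadic steps fit between r1 and r2; the extra
    shell from rounding then costs at most a factor 6 / 5.\<close>
  have "5 * ln 2 \<le> \<Lambda>"
  proof -
    have "5 * ln 2 = ln (2 ^ 5 :: real)" by (subst ln_realpow) auto
    also have "\<dots> \<le> \<Lambda>" using r unfolding \<Lambda>_def by (subst ln_le_cancel_iff) (auto simp: field_simps)
    finally show ?thesis .
  qed
  moreover have "0 < ln (2::real)" by simp
  ultimately have \<Lambda>: "0 < \<Lambda>" "1 \<le> \<Lambda> / (5 * ln 2)"
    by (linarith, simp add: field_simps)
  have "0 \<le> log 2 (r2 / r1)"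
    using r by simp
  then have N: "real N \<le> 6 / 5 * \<Lambda> / ln 2"
  proof -
    have "real N \<le> \<Lambda> / ln 2 + 1"
      using \<open>0 \<le> log 2 (r2 / r1)\<close> of_int_floor_le[of "log 2 (r2 / r1)"]
      by (simp add: N_def) (simp add: log_def \<Lambda>_def)
    also have "\<dots> \<le> \<Lambda> / ln 2 + \<Lambda> / (5 * ln 2)"
      using \<Lambda>(2) by (rule add_left_mono)
    also have "\<dots> = 6 / 5 * \<Lambda> / ln 2"
      by (simp add: field_simps)
    finally show ?thesis .
  qed
  let ?B = "\<lambda>k. ball x0 (r2 / 2 ^ k) \<inter> D"
  let ?c = "\<lambda>k. ennreal ((2 ^ (k + 1) / (r2 * \<Lambda>)) ^ n)"
  have [measurable]: "?B k \<in> sets lebesgue" for k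
    using D(1) by auto
  have r2: "0 < r2" using r by simp
  have "(\<integral>\<^sup>+x\<in>annulus x0 r1 r2. Q x * ennreal (1 / (norm (x - x0) * \<Lambda>)) ^ n \<partial>lebesgue)
      \<le> (\<integral>\<^sup>+x. (\<Sum>k<N. ?c k * (Q x * indicator (?B k) x)) \<partial>lebesgue)"
  proof (rule nn_integral_mono)
    fix x
    show "Q x * ennreal (1 / (norm (x - x0) * \<Lambda>)) ^ n * indicator (annulus x0 r1 r2) x
        \<le> (\<Sum>k<N. ?c k * (Q x * indicator (?B k) x))"
    proof (cases "x \<in> annulus x0 r1 r2 \<and> x \<in> D")
      case False
      then show ?thesis using D(2) by auto
    next
      case True
      then have x: "r1 < norm (x - x0)" "norm (x - x0) < r2" "x \<in> D"
        by (auto simp: annulus_def dist_norm)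
      obtain k where k: "real k \<le> log 2 (r2 / r1)" "norm (x - x0) < r2 / 2 ^ k" "r2 / 2 ^ (k + 1) \<le> norm (x - x0)"
        using dyadic_shell[OF r(1) x(1,2)] .
      have "k < N"
        using k(1) unfolding N_def by linarith
      have "1 / (norm (x - x0) * \<Lambda>) \<le> 1 / (r2 / 2 ^ (k + 1) * \<Lambda>)"
        using k(3) r2 \<Lambda> less_trans[OF r(1) x(1)]
        by (intro divide_left_mono mult_right_mono mult_pos_pos divide_pos_pos) auto
      then have "1 / (norm (x - x0) * \<Lambda>) \<le> 2 ^ (k + 1) / (r2 * \<Lambda>)"
        by simp
      then have "ennreal (1 / (norm (x - x0) * \<Lambda>)) ^ n \<le> ennreal (2 ^ (k + 1) / (r2 * \<Lambda>)) ^ n"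
        by (intro power_mono ennreal_leI) auto
      also have "\<dots> = ?c k"
        using r2 \<Lambda> by (simp add: ennreal_power)
      finally have "Q x * ennreal (1 / (norm (x - x0) * \<Lambda>)) ^ n \<le> Q x * ?c k"
        by (rule mult_left_mono) simp
      also have "\<dots> = ?c k * (Q x * indicator (?B k) x)"
        using k(2) x(3) by (simp add: dist_norm norm_minus_commute mult.commute)
      also have "\<dots> \<le> (\<Sum>k<N. ?c k * (Q x * indicator (?B k) x))"
        using \<open>k < N\<close> by (intro member_le_sum) auto
      finally show ?thesis using True by simp
    qed
  qed
  also have "\<dots> = (\<Sum>k<N. ?c k * (\<integral>\<^sup>+x\<in>?B k. Q x \<partial>lebesgue))"
    using Q by (subst nn_integral_sum) (auto simp: nn_integral_cmult)
  also have "\<dots> \<le> (\<Sum>k<N. ennreal (2 ^ n * c / \<Lambda> ^ n))"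
  proof (rule sum_mono)
    fix k
    have "r2 / 2 ^ k \<le> r2 / 1"
      using r2 by (intro divide_left_mono) auto
    then have "?c k * (\<integral>\<^sup>+x\<in>?B k. Q x \<partial>lebesgue) \<le> ?c k * ennreal (c * (r2 / 2 ^ k) ^ n)"
      using r2 by (intro mult_left_mono ball) auto
    also have "\<dots> = ennreal ((2 ^ (k + 1) / (r2 * \<Lambda>)) ^ n * (c * (r2 / 2 ^ k) ^ n))"
      using r2 \<Lambda> \<open>0 \<le> c\<close> by (intro ennreal_mult[symmetric]) auto
    also have "(2 ^ (k + 1) / (r2 * \<Lambda>)) ^ n * (c * (r2 / 2 ^ k) ^ n) = c * (2 ^ (k + 1) / (r2 * \<Lambda>) * (r2 / 2 ^ k)) ^ n"
      by (simp only: power_mult_distrib mult.left_commute)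
    also have "2 ^ (k + 1) / (r2 * \<Lambda>) * (r2 / 2 ^ k) = 2 / \<Lambda>"
      using r2 by simp
    finally show "?c k * (\<integral>\<^sup>+x\<in>?B k. Q x \<partial>lebesgue) \<le> ennreal (2 ^ n * c / \<Lambda> ^ n)"
      by (simp add: power_divide mult.commute)
  qed
  also have "\<dots> = ennreal (N * (2 ^ n * c / \<Lambda> ^ n))"
    using \<Lambda> \<open>0 \<le> c\<close> by (subst ennreal_mult) (simp_all add: ennreal_of_nat_eq_real_of_nat)
  also have "\<dots> \<le> ennreal (6 / 5 * \<Lambda> / ln 2 * (2 ^ n * c / \<Lambda> ^ n))"
    using \<Lambda> \<open>0 \<le> c\<close> N by (intro ennreal_leI mult_right_mono) auto
  also have "6 / 5 * \<Lambda> / ln 2 * (2 ^ n * c / \<Lambda> ^ n) = 6 / 5 * 2 ^ n * c / (ln 2 * \<Lambda> ^ (n - 1))"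
    using n \<Lambda> by (cases n) (auto simp: field_simps)
  finally show ?thesis
    by (simp add: \<Lambda>_def)
qed

lemma logarithmic_weight:
  assumes "0 < r1" "r1 < r2"
  defines "\<eta> \<equiv> \<lambda>r. ennreal (1 / (r * ln (r2 / r1)))"
  shows "\<eta> \<in> borel_measurable (lebesgue_on {r1<..<r2})"
    and "(\<integral>\<^sup>+r\<in>{r1<..<r2}. \<eta> r \<partial>lebesgue) = 1"
proof -
  have [measurable]: "\<eta> \<in> borel_measurable borel"
    unfolding \<eta>_def by measurable
  then have "\<eta> \<in> borel_measurable lebesgue"
    by (simp add: measurable_completion)
  then show "\<eta> \<in> borel_measurable (lebesgue_on {r1<..<r2})"
    by (rule measurable_restrict_space1)
  have \<Lambda>: "0 < ln (r2 / r1)" using assms by simp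
  have "(\<integral>\<^sup>+r\<in>{r1<..<r2}. \<eta> r \<partial>lebesgue) = (\<integral>\<^sup>+r\<in>{r1..r2}. \<eta> r \<partial>lborel)"
    unfolding nn_integral_completion
    by (intro nn_integral_cong_AE eventually_mono[OF eventually_conj[OF AE_lborel_singleton[of r1] AE_lborel_singleton[of r2]]])
       (auto simp: indicator_def)
  also have "\<dots> = ennreal (1 / ln (r2 / r1)) * (\<integral>\<^sup>+r\<in>{r1..r2}. ennreal (1 / r) \<partial>lborel)"
    using assms \<Lambda>
    by (subst nn_integral_cmult[symmetric])
       (auto intro!: nn_integral_cong simp: \<eta>_def indicator_def mult.commute simp flip: ennreal_mult)
  also have "(\<integral>\<^sup>+r\<in>{r1..r2}. ennreal (1 / r) \<partial>lborel) = ennreal (ln (r2 / r1))"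
    using assms by (subst nn_integral_inverse_ln) (auto simp: ln_div)
  also have "ennreal (1 / ln (r2 / r1)) * ennreal (ln (r2 / r1)) = 1"
    using \<Lambda> by (simp flip: ennreal_mult)
  finally show "(\<integral>\<^sup>+r\<in>{r1<..<r2}. \<eta> r \<partial>lebesgue) = 1" .
qed

lemma ring_Q_mapping_modulus_le:
  fixes x0 :: "real^'n"
  assumes f: "ring_Q_mapping r0 D Q x0 f" and r: "0 < r1" "r1 < r2" "r2 < r0"
  shows "modulus (image_paths f (paths_between (sphere x0 r1) (sphere x0 r2) D))
      \<le> (\<integral>\<^sup>+x\<in>annulus x0 r1 r2. Q x * ennreal (1 / (norm (x - x0) * ln (r2 / r1))) ^ CARD('n) \<partial>lebesgue)"
  using f[unfolded ring_Q_mapping_def, rule_format, of r1 r2 "\<lambda>r. ennreal (1 / (r * ln (r2 / r1)))"]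
    logarithmic_weight[OF r(1,2)] r by simp

text \<open>Pulled back by g, a curve from E to F starts inside the sphere of radius r1 and ends
  outside that of radius r2, so a subcurve joins the spheres within D. Since
  \<open>paths_between\<close> constrains only end points and range, this subcurve may wander
  outside the ring.\<close>

lemma modulus_homeomorphism_ring_le:
  fixes x0 :: "real^'n"
  assumes hom: "homeomorphism D (f ` D) f g" and r: "0 < r1" "r1 < r2"
    and E: "E \<subseteq> f ` (D \<inter> ball x0 r1)" and F: "F \<subseteq> f ` (D - cball x0 r2)"
  shows "modulus (paths_between E F (f ` D))
      \<le> modulus (image_paths f (paths_between (sphere x0 r1) (sphere x0 r2) D))"
proof (rule modulus_le_modulus_subpath)
  fix \<gamma> assume "\<gamma> \<in> paths_between E F (f ` D)"
  then have \<gamma>: "path \<gamma>" "path_image \<gamma> \<subseteq> f ` D" "\<gamma> 0 \<in> E" "\<gamma> 1 \<in> F"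
    by (auto simp: paths_between_def pathstart_def pathfinish_def)
  have gf: "g (f x) = x" if "x \<in> D" for x
    using hom that by (auto simp: homeomorphism_def)
  have fg: "f (g y) = y" if "y \<in> f ` D" for y
    using hom that by (auto simp: homeomorphism_def)
  have im: "\<gamma> t \<in> f ` D" if "t \<in> {0..1}" for t
    using \<gamma>(2) that by (auto simp: path_image_def)
  have path: "path (g \<circ> \<gamma>)"
    using \<gamma>(1,2) hom by (intro path_continuous_image) (auto simp: homeomorphism_def intro: continuous_on_subset)
  define h where "h t = dist x0 (g (\<gamma> t))" for t
  have h: "continuous_on {0..1} h"
    using path unfolding h_def[abs_def] path_def o_def by (intro continuous_intros)
  have h01: "h 0 < r1" "r2 < h 1"
    using \<gamma>(3,4) E F gf by (auto simp: h_def)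
  \<comment> \<open>Fixing v first and then searching u in \<open>{0..v}\<close> yields the two
    crossings in the right order.\<close>
  obtain v where v: "0 \<le> v" "v \<le> 1" "h v = r2"
    using IVT'[of h 0 r2 1] h h01 r by auto
  obtain u where u: "0 \<le> u" "u \<le> v" "h u = r1"
    using IVT'[of h 0 r1 v] continuous_on_subset[OF h, of "{0..v}"] h01 r v by auto
  have "u < v"
    using u v r by (cases "u = v") auto
  let ?\<sigma> = "subpath u v (g \<circ> \<gamma>)"
  have "path_image ?\<sigma> \<subseteq> D"
  proof -
    have "path_image ?\<sigma> \<subseteq> path_image (g \<circ> \<gamma>)"
      using u v by (intro path_image_subpath_subset) auto
    also have "\<dots> \<subseteq> D"
      using \<gamma>(2) gf by (auto simp: path_image_compose)
    finally show ?thesis .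
  qed
  moreover have "path ?\<sigma>"
    using path u v by (intro path_subpath) auto
  ultimately have "?\<sigma> \<in> paths_between (sphere x0 r1) (sphere x0 r2) D"
    using u v by (simp add: paths_between_def pathstart_def pathfinish_def subpath_def h_def)
  then have "f \<circ> ?\<sigma> \<in> image_paths f (paths_between (sphere x0 r1) (sphere x0 r2) D)"
    by (auto simp: image_paths_def)
  moreover have "subpath u v \<gamma> t = (f \<circ> ?\<sigma>) t" if t: "t \<in> {0..1}" for t
  proof -
    have "subpath u v \<gamma> t \<in> path_image (subpath u v \<gamma>)"
      using t by (auto simp: path_image_def)
    also have "\<dots> \<subseteq> f ` D"
      using path_image_subpath_subset[of u v \<gamma>] u v \<gamma>(2) by auto
    finally show ?thesis
      using fg by (simp add: subpath_def)
  qed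
  ultimately show "\<exists>u v. 0 \<le> u \<and> u < v \<and> v \<le> 1 \<and>
      (\<exists>\<gamma>'\<in>image_paths f (paths_between (sphere x0 r1) (sphere x0 r2) D). \<forall>t\<in>{0..1}. subpath u v \<gamma> t = \<gamma>' t)"
    using u v \<open>u < v\<close> by blast
qed

section \<open>From the two modulus bounds to a distance bound\<close>

lemma powr_perturbation:
  fixes p s K L Y :: real
  assumes "0 < p" "0 < s" "s < 1" "0 \<le> K" "0 \<le> L" "0 \<le> Y" and le: "Y powr p \<le> L powr p + K"
  shows "s * Y \<le> L + (K / (1 - s powr p)) powr (1 / p)"
proof -
  have sp: "0 < s powr p" "s powr p < 1"
    using assms powr_less_mono2[of p s 1] by auto
  show ?thesis
  \<comment> \<open>Either the error K fits into the share of Y powr p given up by s, and then s * Y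
    \<le> L, or Y itself is bounded by the constant. With s = 1 no additive constant would do for p
    < 1 and K > 0.\<close>
  proof (cases "K \<le> Y powr p * (1 - s powr p)")
    case True
    then have "(s * Y) powr p \<le> L powr p"
      using assms by (simp add: powr_mult algebra_simps)
    then have "s * Y \<le> L"
      using assms powr_less_mono2[of p L "s * Y"] by (meson not_le)
    then show ?thesis by (simp add: add_increasing2)
  next
    case False
    then have "Y powr p \<le> K / (1 - s powr p)"
      using sp by (simp add: field_simps)
    then have "(Y powr p) powr (1 / p) \<le> (K / (1 - s powr p)) powr (1 / p)"
      using assms by (intro powr_mono2) auto
    then have "Y \<le> (K / (1 - s powr p)) powr (1 / p)"
      using assms by (simp add: powr_powr)
    moreover have "s * Y \<le> Y"
      using assms by (simp add: mult_left_le_one_le)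
    ultimately show ?thesis
      using assms by linarith
  qed
qed

text \<open>The dyadic estimate with a single factor \<open>2 ^ n\<close> instead of \<open>2 ^ (n + 1)\<close> leaves a factor
  \<open>4 / 5\<close> to spare, so that the true exponent is at least \<open>exponent_gain n * beta_exp n A0 C\<close>. The gain
  is what makes the constant independent of the scale on which \<open>Q\<close> is controlled.\<close>

definition gain_base :: "nat \<Rightarrow> real" where
  "gain_base n = (4 / 5) powr (1 / (real n - 1))"

definition exponent_gain :: "nat \<Rightarrow> real" where
  "exponent_gain n = gain_base n powr (- 1 / 2)"

text \<open>The exponential is that of the additive constant in \<open>powr_perturbation\<close>; 6
  * R0 comes from undoing the logarithm of 6 * R0 / d.\<close>

definition hoelder_const :: "nat \<Rightarrow> real \<Rightarrow> real \<Rightarrow> real" where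
  "hoelder_const n \<delta> R0 = 6 * R0 * exp ((curve_const n \<delta> R0 * (n * unit_ball_vol n) powr (1 / n)
     / (1 - (gain_base n powr (1 / 2)) powr (1 - 1 / n))) powr (1 / (1 - 1 / n)))"

lemma gain_base_bounds:
  assumes "2 \<le> n"
  shows "0 < gain_base n" "gain_base n < 1"
  using assms powr_less_mono2[of "1 / (real n - 1)" "4 / 5" 1] by (auto simp: gain_base_def)

lemma exponent_gain_gt_1: "2 \<le> n \<Longrightarrow> 1 < exponent_gain n"
  using gain_base_bounds[of n] powr_less_mono2_neg[of "- 1 / 2" "gain_base n" 1] by (simp add: exponent_gain_def)

lemma distance_bound_from_modulus:
  fixes M :: ennreal
  assumes n: "2 \<le> n" and pos: "0 < A0" "0 < C" "0 < \<delta>" "0 < R0" "0 < d" "d < 2 * R0" and r: "0 < r1" "r1 < r2"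
    and upper: "M \<le> ennreal (A0 * (6 / 5 * 2 ^ n * (5 / 4 * C * unit_ball_vol n) / (ln 2 * ln (r2 / r1) ^ (n - 1))))"
    and lower: "\<And>\<mu>. 0 < \<mu> \<Longrightarrow> M < ennreal (\<mu> ^ n) \<Longrightarrow>
      1 \<le> \<mu> * (curve_const n \<delta> R0 + ln (6 * R0 / d) powr (1 - 1 / n) / (n * unit_ball_vol n) powr (1 / n))"
  shows "d \<le> hoelder_const n \<delta> R0 * (r1 / r2) powr (exponent_gain n * beta_exp n A0 C)"
proof -
  define \<omega> where "\<omega> = unit_ball_vol n"
  define \<beta> where "\<beta> = beta_exp n A0 C"
  define \<Lambda> where "\<Lambda> = ln (r2 / r1)"
  define L where "L = ln (6 * R0 / d)"
  define p where "p = 1 - 1 / real n"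
  define \<theta> where "\<theta> = gain_base n"
  define W where "W = (n * \<omega>) powr (1 / n)"
  define K where "K = curve_const n \<delta> R0"
  \<comment> \<open>Half of the gain is spent here on \<open>powr_perturbation\<close>; the other
    half, s / \<theta> = \<theta> powr (- 1 / 2), survives as \<open>exponent_gain\<close>.\<close>
  define s where "s = \<theta> powr (1 / 2)"
  \<comment> \<open>A density is available only if the modulus is strictly below
    \<open>\<mu> ^ n\<close>, so the factor 4 / 5 is put above the 3 / 4 of the upper bound and
    still below 1.\<close>
  define \<mu> where "\<mu> = (4 / 5 * (n * \<omega>) / (\<beta> * \<Lambda>) ^ (n - 1)) powr (1 / n)"
  have \<omega>: "0 < \<omega>" by (simp add: \<omega>_def)
  have \<Lambda>: "0 < \<Lambda>" using r by (simp add: \<Lambda>_def)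
  have L: "0 < L" using pos by (simp add: L_def)
  have p: "0 < p" using n by (simp add: p_def)
  have \<theta>: "0 < \<theta>" "\<theta> < 1" using gain_base_bounds[OF n] by (auto simp: \<theta>_def)
  have W: "0 < W" using \<omega> n by (simp add: W_def)
  have K: "0 \<le> K" unfolding K_def using n pos by (intro curve_const_nonneg) auto
  have n1: "real (n - 1) = real n - 1" using n by simp
  have base: "0 < real n * ln 2 / (A0 * C * 2 ^ (n + 1))"
    using n pos by simp
  have \<beta>: "0 < \<beta>"
    using n pos by (simp add: \<beta>_def beta_exp_def)
  have "\<beta> ^ (n - 1) = \<beta> powr (real n - 1)"
    using \<beta> n1 by (simp add: powr_realpow[symmetric])
  also have "\<dots> = real n * ln 2 / (A0 * C * 2 ^ (n + 1))"
    using n pos by (simp add: \<beta>_def beta_exp_def powr_powr)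
  finally have \<beta>n: "\<beta> ^ (n - 1) = real n * ln 2 / (A0 * C * 2 ^ (n + 1))" .
  have \<mu>0: "0 < 4 / 5 * (n * \<omega>) / (\<beta> * \<Lambda>) ^ (n - 1)"
    using \<beta> \<Lambda> \<omega> n by simp
  then have \<mu>: "0 < \<mu>"
    unfolding \<mu>_def by (simp only: powr_gt_zero)
  have \<mu>n: "\<mu> ^ n = 4 / 5 * (n * \<omega>) / (\<beta> * \<Lambda>) ^ (n - 1)"
  proof -
    have "\<mu> ^ n = \<mu> powr n" using \<mu> by (simp add: powr_realpow)
    moreover have "(X powr (1 / n)) powr n = X" if "0 < X" for X
      using that n by (simp add: powr_powr)
    ultimately show ?thesis using \<mu>0 unfolding \<mu>_def by metis
  qed
  \<comment> \<open>The product 6 / 5 * 5 / 4 * 2 ^ n is 3 / 4 of the 2 ^ (n + 1) contained in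
    \<beta>.\<close>
  have "A0 * (6 / 5 * 2 ^ n * (5 / 4 * C * \<omega>) / (ln 2 * \<Lambda> ^ (n - 1))) = 3 / 4 * (n * \<omega>) / (\<beta> * \<Lambda>) ^ (n - 1)"
    unfolding power_mult_distrib \<beta>n using n pos \<Lambda> by (simp add: field_simps)
  also have "\<dots> < \<mu> ^ n"
    unfolding \<mu>n using \<beta> \<Lambda> \<omega> n by (intro divide_strict_right_mono) auto
  finally have "M < ennreal (\<mu> ^ n)"
    using upper \<mu> unfolding \<omega>_def[symmetric] \<Lambda>_def[symmetric]
    by (auto intro: le_less_trans simp: ennreal_lessI)
  from lower[OF \<mu> this] have low: "1 \<le> \<mu> * (K + L powr p / W)"
    by (simp add: K_def L_def p_def W_def \<omega>_def)
  \<comment> \<open>As \<theta> powr p = (4 / 5) powr (1 / n), dividing by \<theta> absorbs the 4 /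
    5 and gives \<mu> = W / Y powr p.\<close>
  define Y where "Y = \<beta> * \<Lambda> / \<theta>"
  have Y: "0 < Y" using \<beta> \<Lambda> \<theta> by (simp add: Y_def)
  have "\<mu> = W / Y powr p"
  proof -
    have "\<theta> powr p = (4 / 5) powr (1 / n)"
    proof -
      have "1 / (real n - 1) * p = 1 / n"
        using n by (simp add: p_def field_simps)
      then show ?thesis by (simp add: \<theta>_def gain_base_def powr_powr)
    qed
    moreover have "((\<beta> * \<Lambda>) ^ (n - 1)) powr (1 / n) = (\<beta> * \<Lambda>) powr p"
    proof -
      have "(real n - 1) * (1 / n) = p"
        using n by (simp add: p_def field_simps)
      then show ?thesis
        using \<beta> \<Lambda> n1 by (simp add: powr_realpow[symmetric] powr_powr)
    qed
    ultimately show ?thesis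
      using \<beta> \<Lambda> \<omega> \<theta> n by (simp add: \<mu>_def Y_def W_def powr_divide powr_mult mult_ac)
  qed
  then have "1 \<le> W * (K + L powr p / W) / Y powr p"
    using low by simp
  then have "Y powr p \<le> W * (K + L powr p / W)"
    using Y by (simp add: pos_le_divide_eq)
  also have "\<dots> = L powr p + K * W"
    using W by (simp add: field_simps)
  finally have "s * Y \<le> L + (K * W / (1 - s powr p)) powr (1 / p)"
    using p \<theta> K W L Y powr_less_mono2[of "1 / 2" \<theta> 1]
    by (intro powr_perturbation) (auto simp: s_def)
  moreover have "s * Y = exponent_gain n * \<beta> * \<Lambda>"
  proof -
    have "s / \<theta> = \<theta> powr (1 / 2 - 1)"
      unfolding s_def using \<theta> by (simp only: powr_diff powr_one)
    moreover have "s * Y = s / \<theta> * \<beta> * \<Lambda>"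
      by (simp add: Y_def)
    ultimately show ?thesis
      by (simp add: exponent_gain_def \<theta>_def)
  qed
  ultimately have "exponent_gain n * \<beta> * \<Lambda> \<le> L + (K * W / (1 - s powr p)) powr (1 / p)"
    by simp
  then have "exp (exponent_gain n * \<beta> * \<Lambda>) \<le> exp (L + (K * W / (1 - s powr p)) powr (1 / p))"
    by simp
  also have "\<dots> = hoelder_const n \<delta> R0 / d"
    using pos by (simp add: exp_add L_def hoelder_const_def K_def W_def \<omega>_def s_def \<theta>_def p_def)
  finally have "d * exp (exponent_gain n * \<beta> * \<Lambda>) \<le> hoelder_const n \<delta> R0"
    using pos by (simp add: field_simps)
  then have "d \<le> hoelder_const n \<delta> R0 / exp (exponent_gain n * \<beta> * \<Lambda>)"
    by (simp add: pos_le_divide_eq)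
  moreover have "(r1 / r2) powr (exponent_gain n * \<beta>) = exp (- (exponent_gain n * \<beta> * \<Lambda>))"
    using r by (simp add: powr_def \<Lambda>_def ln_div algebra_simps)
  ultimately show ?thesis
    unfolding \<beta>_def[symmetric] by (simp add: exp_minus divide_inverse)
qed

lemma hoelder_const_pos: "0 < R0 \<Longrightarrow> 0 < hoelder_const n \<delta> R0"
  by (simp add: hoelder_const_def)

section \<open>The mapping class\<close>

lemma Omega_eq_unit_ball_vol: "Omega TYPE('n::finite) = unit_ball_vol CARD('n)"
  using content_ball[of 1 "0::real^'n"] by (simp add: Omega_def)

lemma ball_integral_bound_from_Limsup:
  fixes x0 :: "real^'n" and Q :: "real^'n \<Rightarrow> ennreal"
  assumes "0 < C"
    and lim: "Limsup (at_right 0) (\<lambda>\<epsilon>. (\<integral>\<^sup>+x\<in>ball x0 \<epsilon> \<inter> D. Q x \<partial>lebesgue)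
           / ennreal (Omega TYPE('n) * \<epsilon> ^ CARD('n))) \<le> ennreal C"
  obtains b where "0 < b" "\<And>r. 0 < r \<Longrightarrow> r < b \<Longrightarrow>
    (\<integral>\<^sup>+x\<in>ball x0 r \<inter> D. Q x \<partial>lebesgue) \<le> ennreal (5 / 4 * C * unit_ball_vol CARD('n) * r ^ CARD('n))"
proof -
  let ?I = "\<lambda>r. \<integral>\<^sup>+x\<in>ball x0 r \<inter> D. Q x \<partial>lebesgue"
  let ?v = "\<lambda>r. unit_ball_vol CARD('n) * r ^ CARD('n)"
  \<comment> \<open>A strictly larger constant turns the limsup into a bound for all small radii; 5
    / 4 is affordable because 6 / 5 * 5 / 4 stays below 2.\<close>
  have "ennreal C < ennreal (5 / 4 * C)"
    using assms(1) by (simp add: ennreal_less_iff)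
  with lim have "Limsup (at_right 0) (\<lambda>r. ?I r / ennreal (?v r)) < ennreal (5 / 4 * C)"
    unfolding Omega_eq_unit_ball_vol by (rule le_less_trans)
  then have "\<forall>\<^sub>F r in at_right 0. ?I r / ennreal (?v r) < ennreal (5 / 4 * C)"
    by (rule Limsup_lessD)
  then obtain b where b: "0 < b" "\<And>r. 0 < r \<Longrightarrow> r < b \<Longrightarrow> ?I r / ennreal (?v r) < ennreal (5 / 4 * C)"
    unfolding eventually_at_right_field by auto
  have "?I r \<le> ennreal (5 / 4 * C * unit_ball_vol CARD('n) * r ^ CARD('n))" if r: "0 < r" "r < b" for r
  proof -
    have v: "0 < ?v r" using r by simp
    have "x = x / ennreal w * ennreal w" if "0 < w" for x w
      using that by (simp add: ennreal_divide_times)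
    from this[OF v] have "?I r = ?I r / ennreal (?v r) * ennreal (?v r)" .
    also have "\<dots> \<le> ennreal (5 / 4 * C) * ennreal (?v r)"
      using b(2)[OF r] by (intro mult_right_mono) auto
    also have "\<dots> = ennreal (5 / 4 * C * ?v r)"
      using v assms(1) by (intro ennreal_mult[symmetric]) auto
    finally show ?thesis by (simp add: mult.assoc)
  qed
  then show ?thesis using that b(1) by blast
qed

text \<open>The scale r2 stays fixed, given by D, A, Q and the radii, while r1 follows the two
  points; all decay comes from r1 / r2.\<close>

lemma QED_ring_family_distance_bound:
  fixes x0 :: "real^'n" and Q :: "real^'n \<Rightarrow> ennreal"
  defines "n \<equiv> CARD('n)"
  assumes n: "2 \<le> n" and pos: "0 < C" "0 < A0" "0 < R0" "0 < \<delta>"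
    and D: "open D" and A: "path_connected A" "compact A" "A \<subseteq> D" "A \<inter> cball x0 r2 = {}"
    and Q: "Q \<in> borel_measurable lebesgue" "\<And>x. x \<notin> D \<Longrightarrow> Q x = 0"
    and ball: "\<And>r. 0 < r \<Longrightarrow> r \<le> r2 \<Longrightarrow>
      (\<integral>\<^sup>+x\<in>ball x0 r \<inter> D. Q x \<partial>lebesgue) \<le> ennreal (5 / 4 * C * unit_ball_vol n * r ^ n)"
    and f: "f \<in> QED_ring_family A0 R0 Q A \<delta> r0 D x0"
    and r: "0 < r1" "32 * r1 \<le> r2" "r2 < r0" and conn: "connected (ball x0 r1 \<inter> D)"
    and xy: "x \<in> ball x0 r1 \<inter> D" "y \<in> ball x0 r1 \<inter> D"
  shows "norm (f x - f y) \<le> hoelder_const n \<delta> R0 * (r1 / r2) powr (exponent_gain n * beta_exp n A0 C)"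
proof (cases "f x = f y")
  case True
  then show ?thesis
    using hoelder_const_pos[OF pos(3), of n \<delta>] by simp
next
  case False
  from f obtain g where hom: "homeomorphism D (f ` D) f g" and R0: "f ` D \<subseteq> ball 0 R0"
    and ring: "ring_Q_mapping r0 D Q x0 f" and diam: "\<delta> \<le> diameter (f ` A)" and QED: "QED_domain A0 (f ` D)"
    by (auto simp: QED_ring_family_def)
  have contf: "continuous_on D f" using hom by (simp add: homeomorphism_def)
  have "path_connected (ball x0 r1 \<inter> D)"
    using conn D by (intro connected_open_path_connected) auto
  then obtain \<gamma> where \<gamma>: "path \<gamma>" "path_image \<gamma> \<subseteq> ball x0 r1 \<inter> D" "pathstart \<gamma> = x" "pathfinish \<gamma> = y"
    using xy unfolding path_connected_def by blast
  have fA: "compact (f ` A)"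
    using A contf by (intro compact_continuous_image) (auto intro: continuous_on_subset)
  have "f ` A \<noteq> {}"
    using diam pos by auto
  then obtain u v where uv: "u \<in> A" "v \<in> A" "dist (f u) (f v) = diameter (f ` A)"
    using diameter_compact_attained[OF fA] by auto
  \<comment> \<open>Joining preimages of a diametral pair inside A makes the second continuum a
    curve whose end points are at least \<delta> apart, as the lower bound requires.\<close>
  obtain \<sigma> where \<sigma>: "path \<sigma>" "path_image \<sigma> \<subseteq> A" "pathstart \<sigma> = u" "pathfinish \<sigma> = v"
    using A(1) uv unfolding path_connected_def by blast
  have path: "path (f \<circ> \<gamma>)" "path (f \<circ> \<sigma>)"
    using \<gamma> \<sigma> A(3) contf by (auto intro!: path_continuous_image intro: continuous_on_subset)
  let ?E = "path_image (f \<circ> \<gamma>)" and ?F = "path_image (f \<circ> \<sigma>)"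
  have E: "?E \<subseteq> f ` (D \<inter> ball x0 r1)"
    using \<gamma>(2) by (auto simp: path_image_compose)
  have F: "?F \<subseteq> f ` (D - cball x0 r2)"
    using \<sigma>(2) A(3,4) by (fastforce simp: path_image_compose)
  define M where "M = modulus (paths_between ?E ?F UNIV)"
  define d where "d = dist (f x) (f y)"
  have "continuum ?E" "continuum ?F"
    using path by (auto simp: continuum_def compact_path_image connected_path_image)
  then have "M \<le> ennreal A0 * modulus (paths_between ?E ?F (f ` D))"
    using QED E F unfolding QED_domain_def M_def by blast
  also have "\<dots> \<le> ennreal A0 * modulus (image_paths f (paths_between (sphere x0 r1) (sphere x0 r2) D))"
    using r E F by (intro mult_left_mono modulus_homeomorphism_ring_le[OF hom]) auto
  also have "\<dots> \<le> ennreal A0 * (\<integral>\<^sup>+x\<in>annulus x0 r1 r2. Q x * ennreal (1 / (norm (x - x0) * ln (r2 / r1))) ^ n \<partial>lebesgue)"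
    using ring_Q_mapping_modulus_le[OF ring, of r1 r2] r unfolding n_def by (intro mult_left_mono) auto
  also have "\<dots> \<le> ennreal A0 * ennreal (6 / 5 * 2 ^ n * (5 / 4 * C * unit_ball_vol n) / (ln 2 * ln (r2 / r1) ^ (n - 1)))"
    using weighted_annulus_integral[OF Q(1) _ Q(2) ball[unfolded n_def] _ r(1,2)] D pos
    unfolding n_def by (intro mult_left_mono) auto
  also have "\<dots> = ennreal (A0 * (6 / 5 * 2 ^ n * (5 / 4 * C * unit_ball_vol n) / (ln 2 * ln (r2 / r1) ^ (n - 1))))"
    using pos r by (intro ennreal_mult[symmetric]) auto
  finally have upper: "M \<le> \<dots>" .
  have lower: "1 \<le> \<mu> * (curve_const n \<delta> R0 + ln (6 * R0 / d) powr (1 - 1 / n) / (n * unit_ball_vol n) powr (1 / n))"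
    if "0 < \<mu>" "M < ennreal (\<mu> ^ n)" for \<mu>
  proof -
    have "?E \<subseteq> ball 0 R0" "?F \<subseteq> ball 0 R0"
      using E F R0 by blast+
    then show ?thesis
      using modulus_connecting_curves_lower[OF path, of R0 \<delta> \<mu>] that False pos(4) diam uv(3)
      by (simp add: n_def M_def d_def pathstart_compose pathfinish_compose \<gamma>(3,4) \<sigma>(3,4))
  qed
  have "0 < d" using False by (simp add: d_def)
  moreover have "d < 2 * R0"
  proof -
    have "f x \<in> ball 0 R0" "f y \<in> ball 0 R0"
      using xy R0 by auto
    then show ?thesis
      using dist_triangle[of "f x" "f y" 0] by (simp add: d_def dist_commute)
  qed
  ultimately have "d \<le> hoelder_const n \<delta> R0 * (r1 / r2) powr (exponent_gain n * beta_exp n A0 C)"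
    using distance_bound_from_modulus[OF n pos(2,1,4,3) _ _ r(1) _ upper lower] r by auto
  then show ?thesis
    by (simp add: d_def dist_norm)
qed

text \<open>The bound on r says that r powr (\<kappa> - 1) \<le> c powr \<kappa>, hence (r / c) powr
  \<kappa> \<le> r; raising to the power \<beta> removes the scale c. It needs \<kappa> > 1.\<close>

lemma powr_gain_absorbs_scale:
  fixes b c r \<beta> \<kappa> :: real
  assumes "1 < \<kappa>" "0 \<le> \<beta>" "0 < r" "0 < c" "r \<le> c powr (\<kappa> / (\<kappa> - 1))"
  shows "(r / c) powr (\<kappa> * \<beta>) \<le> r powr \<beta>"
proof -
  have "r powr (\<kappa> - 1) \<le> (c powr (\<kappa> / (\<kappa> - 1))) powr (\<kappa> - 1)"
    using assms by (intro powr_mono2) auto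
  also have "\<dots> = c powr \<kappa>"
    using assms by (simp add: powr_powr)
  finally have "r powr \<kappa> \<le> r * c powr \<kappa>"
    using assms by (simp add: powr_diff field_simps)
  then have "(r / c) powr \<kappa> \<le> r"
    using assms by (simp add: powr_divide field_simps)
  then have "((r / c) powr \<kappa>) powr \<beta> \<le> r powr \<beta>"
    using assms by (intro powr_mono2) auto
  then show ?thesis by (simp add: powr_powr)
qed

theorem theorem1p1:
  fixes x0 :: "real^'n" and C :: real
  assumes "CARD('n) \<ge> 2" and "C > 0"
  shows "\<exists>\<alpha>::real \<Rightarrow> real \<Rightarrow> real. (\<forall>\<delta>>0. \<forall>R0>0. \<alpha> \<delta> R0 > 0) \<and>
    (\<forall>(D::(real^'n) set) (A::(real^'n) set) (Q::real^'n \<Rightarrow> ennreal) (r0::real).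
       open D \<and> connected D \<and> x0 \<in> frontier D \<and>
       continuum A \<and> path_connected A \<and> A \<subseteq> D \<and>
       Q \<in> borel_measurable (lebesgue_on D) \<and> (\<forall>x. x \<notin> D \<longrightarrow> Q x = 0) \<and>
       r0 > 0 \<and>
       (\<exists>r0'>0. \<forall>r. 0 < r \<and> r < r0' \<longrightarrow> connected (ball x0 r \<inter> D)) \<and>
       Limsup (at_right 0) (\<lambda>\<epsilon>. (\<integral>\<^sup>+x\<in>ball x0 \<epsilon> \<inter> D. Q x \<partial>lebesgue)
           / ennreal (Omega TYPE('n) * \<epsilon> ^ CARD('n))) \<le> ennreal C
       \<longrightarrow>
       (\<exists>\<epsilon>0>0. \<forall>A0>0. \<forall>R0>0. \<forall>\<delta>>0.
          \<forall>f\<in>QED_ring_family A0 R0 Q A \<delta> r0 D x0.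
          \<forall>x\<in>ball x0 \<epsilon>0 \<inter> D. \<forall>y\<in>ball x0 \<epsilon>0 \<inter> D.
            norm (f x - f y) \<le> \<alpha> \<delta> R0 *
              max (norm (x - x0) powr beta_exp CARD('n) A0 C)
                  (norm (y - x0) powr beta_exp CARD('n) A0 C)))"
proof (intro exI[of _ "hoelder_const CARD('n)"] conjI allI impI; (elim conjE exE)?)
  \<comment> \<open>The witness involves only n, \<delta> and R0, so it can precede the domain, Q
    and the radii.\<close>
  show "0 < hoelder_const CARD('n) \<delta> R0" if "0 < R0" for \<delta> R0
    using that by (rule hoelder_const_pos)
next
  fix D A :: "(real^'n) set" and Q :: "real^'n \<Rightarrow> ennreal" and r0 r0' :: real
  assume D: "open D" "x0 \<in> frontier D" and A: "continuum A" "path_connected A" "A \<subseteq> D"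
    and Q: "Q \<in> borel_measurable (lebesgue_on D)" "\<forall>x. x \<notin> D \<longrightarrow> Q x = 0"
    and r0: "0 < r0" and r0': "0 < r0'" "\<forall>r. 0 < r \<and> r < r0' \<longrightarrow> connected (ball x0 r \<inter> D)"
    and lim: "Limsup (at_right 0) (\<lambda>\<epsilon>. (\<integral>\<^sup>+x\<in>ball x0 \<epsilon> \<inter> D. Q x \<partial>lebesgue)
           / ennreal (Omega TYPE('n) * \<epsilon> ^ CARD('n))) \<le> ennreal C"
  let ?n = "CARD('n)" and ?\<kappa> = "exponent_gain CARD('n)"
  have x0: "x0 \<notin> D"
    using D by (simp add: frontier_def interior_open)
  have Qm: "Q \<in> borel_measurable lebesgue"
  proof -
    have "(\<lambda>x. Q x * indicator D x) \<in> borel_measurable lebesgue"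
      using Q(1) D(1) by (subst (asm) borel_measurable_restrict_space_iff_ennreal) auto
    also have "(\<lambda>x. Q x * indicator D x) = Q"
      using Q(2) by (auto simp: indicator_def)
    finally show ?thesis .
  qed
  obtain b where b: "0 < b" "\<And>r. 0 < r \<Longrightarrow> r < b \<Longrightarrow>
      (\<integral>\<^sup>+x\<in>ball x0 r \<inter> D. Q x \<partial>lebesgue) \<le> ennreal (5 / 4 * C * unit_ball_vol ?n * r ^ ?n)"
    using ball_integral_bound_from_Limsup[OF assms(2) lim] by blast
  have "open (- A)"
    using A(1) by (simp add: continuum_def compact_imp_closed open_Compl)
  then obtain e where e: "0 < e" "ball x0 e \<subseteq> - A"
    using x0 A(3) by (metis ComplI open_contains_ball subsetD)
  \<comment> \<open>Halving keeps r2 strictly below all four scales: control of Q, distance from x0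
    to A, ring condition, connectedness.\<close>
  define r2 where "r2 = min (min b e) (min r0 r0') / 2"
  have r2: "0 < r2" "r2 < b" "r2 < e" "r2 < r0" "r2 < r0'"
    using b(1) e(1) r0 r0'(1) by (auto simp: r2_def)
  have Ar2: "A \<inter> cball x0 r2 = {}"
  proof -
    have "cball x0 r2 \<subseteq> ball x0 e" using r2 by (auto)
    then show ?thesis using e(2) by blast
  qed
  \<comment> \<open>The ring with inner radius 2 r needs 32 * (2 * r) \<le> r2, hence 64; the other
    bound is that of \<open>powr_gain_absorbs_scale\<close> for c = r2 / 2. Because the gain is a
    factor depending on n alone, neither involves A0, R0 or \<delta>.\<close>
  define \<epsilon>0 where "\<epsilon>0 = min (r2 / 64) ((r2 / 2) powr (?\<kappa> / (?\<kappa> - 1)))"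
  have "norm (f x - f y) \<le> hoelder_const ?n \<delta> R0 *
      max (norm (x - x0) powr beta_exp ?n A0 C) (norm (y - x0) powr beta_exp ?n A0 C)"
    if pos: "0 < A0" "0 < R0" "0 < \<delta>" and f: "f \<in> QED_ring_family A0 R0 Q A \<delta> r0 D x0"
      and xy: "x \<in> ball x0 \<epsilon>0 \<inter> D" "y \<in> ball x0 \<epsilon>0 \<inter> D" for A0 R0 \<delta> f x y
  proof -
    \<comment> \<open>One of the points lies on the sphere of radius r, so the open ball of radius 2
      r is used; r is positive because x0, a boundary point of the open set D, is not in D.\<close>
    define r where "r = max (norm (x - x0)) (norm (y - x0))"
    have "x \<noteq> x0" using xy x0 by auto
    then have r: "0 < r" "r < r2 / 64" "r < (r2 / 2) powr (?\<kappa> / (?\<kappa> - 1))"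
      using xy by (auto simp: r_def \<epsilon>0_def dist_norm norm_minus_commute less_max_iff_disj)
    have in_ball: "x \<in> ball x0 (2 * r) \<inter> D" "y \<in> ball x0 (2 * r) \<inter> D"
      using xy r(1) by (auto simp: r_def dist_norm norm_minus_commute)
    have "norm (f x - f y) \<le> hoelder_const ?n \<delta> R0 * (2 * r / r2) powr (?\<kappa> * beta_exp ?n A0 C)"
      using QED_ring_family_distance_bound[OF assms(1) assms(2) pos D(1) A(2) _ A(3) Ar2 Qm _ _ f, of "2 * r" x y]
        A(1) Q(2) b(2) r r2 r0'(2) in_ball by (auto simp: continuum_def)
    also have "(2 * r / r2) powr (?\<kappa> * beta_exp ?n A0 C) = (r / (r2 / 2)) powr (?\<kappa> * beta_exp ?n A0 C)"
      by (simp add: mult.commute)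
    also have "\<dots> \<le> r powr beta_exp ?n A0 C"
      using r r2 exponent_gain_gt_1[OF assms(1)] by (intro powr_gain_absorbs_scale) (auto simp: beta_exp_def)
    also have "\<dots> \<le> max (norm (x - x0) powr beta_exp ?n A0 C) (norm (y - x0) powr beta_exp ?n A0 C)"
      by (simp add: r_def max_def)
    finally show ?thesis
      using hoelder_const_pos[OF pos(2), of ?n \<delta>] by simp
  qed
  moreover have "0 < \<epsilon>0"
    using r2 by (simp add: \<epsilon>0_def)
  ultimately show "\<exists>\<epsilon>0>0. \<forall>A0>0. \<forall>R0>0. \<forall>\<delta>>0.
          \<forall>f\<in>QED_ring_family A0 R0 Q A \<delta> r0 D x0.
          \<forall>x\<in>ball x0 \<epsilon>0 \<inter> D. \<forall>y\<in>ball x0 \<epsilon>0 \<inter> D.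
            norm (f x - f y) \<le> hoelder_const ?n \<delta> R0 *
              max (norm (x - x0) powr beta_exp ?n A0 C) (norm (y - x0) powr beta_exp ?n A0 C)"
    by blast
qed

end
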